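(* Let $\alpha\in(0,1)$ and suppose that Assumption A (stated in the context) holds for every $h\in\mathcal{H}$. Let $\lambda=\{f(g(\theta_0)|\theta_0)\nabla_\theta g(\theta_0)\}^{-1}$, let $Y_{(1)}=\min\{Y_1,\ldots,Y_n\}$, and define the test $$\phi_n^-(Y^n)=\begin{cases}1 & \text{if } Y_{(1)}>g\left(\theta_0+\frac{\lambda}{n}\log\frac1\alpha\right),\\ 0 & \text{if } Y_{(1)}\le g\left(\theta_0+\frac{\lambda}{n}\log\frac1\alpha\right).\end{cases}$$ Then $\{\phi_n^-(Y^n)\}$ is asymptotically uniformly most powerful (AUMP) in $\mathcal{H}$ at asymptotic level $\alpha$ for testing $H_0^-:h\le 0$ against $H_1^-:h>0$. That is, $\limsup_n E_{\theta_0+h/n}[\phi_n^-]\le\alpha$ for every $h\le 0$ in $\mathcal{H}$, and for every other sequence of tests $\{\psi_n\}$ satisfying $\limsup_n E_{\theta_0+h/n}[\psi_n]\le\alpha$ for every $h\le0$ in $\mathcal{H}$, $$\liminf_n E_{\theta_0+h/n}[\phi_n^-]\ \ge\ \limsup_n E_{\theta_0+h/n}[\psi_n]\quad\text{for every } h>0 \text{ in } \mathcal{H}.$$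
   Context: Model. A scalar random variable $Y\in\mathcal{Y}\subset\mathbb{R}$ has Lebesgue density $f(y|\theta)\mathbb{I}\{y\ge g(\theta)\}$, where $\theta\in\Theta\subset\mathbb{R}$ is a scalar parameter and $\mathbb{I}\{\cdot\}$ is the indicator function. Fix $\theta_0\in\Theta$ and reparametrize locally by $h=n(\theta-\theta_0)\in\mathcal{H}\subset\mathbb{R}$. One observes an i.i.d. sample $Y^n=(Y_1,\ldots,Y_n)$ of $Y$. $P_{\theta_0+h/n}$ and $E_{\theta_0+h/n}$ denote probability and expectation when $Y_1,\dots,Y_n$ are i.i.d. from the density with $\theta=\theta_0+h/n$ ($n$ large enough that $\theta_0+h/n\in\Theta$). A test is a measurable function of $Y^n$ with values in $[0,1]$, interpreted as the probability of rejecting the null. Assumption A. (i) $\{Y_i\}_{i=1}^n$ is an i.i.d. sample of $Y$ with the Lebesgue density $f(y|\theta)\mathbb{I}\{y\ge g(\theta)\}$. $\Theta$ is convex, $\theta_0\in\mathrm{int}(\Theta)$, and $0\in\mathcal{H}$. (ii) $f(y|\theta)$ is twice continuously differentiable in $\theta$ for all $y$. In some open neighborhood $\mathcal{N}$ of $\theta_0$: $f(y|\theta)$ and $\nabla_\theta f(y|\theta)$ are continuous in $y$ for $\theta\in\mathcal{N}$; there is a constant $C$ such that $0<f(y|\theta)<C<\infty$ and $|\nabla_\theta f(y|\theta)|<C<\infty$ for all $y$ and $\theta\in\mathcal{N}$; and $$\int\sup_{\theta\in\mathcal{N}}\|\nabla_\theta f(y|\theta)\|\,\mathbb{I}\{y\ge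 g(\theta)\}\,dy<\infty,$$ $$\int\sup_{\theta,\bar\theta\in\mathcal{N}}\frac{\|\nabla_\theta f(y|\bar\theta)\|^2}{f(y|\bar\theta)^2}\mathbb{I}\{y\ge g(\theta)\}f(y|\theta)\,dy<\infty,$$ $$\int\sup_{\theta,\bar\theta\in\mathcal{N}}\frac{\|\nabla_{\theta\theta} f(y|\bar\theta)\|}{f(y|\bar\theta)}\mathbb{I}\{y\ge g(\theta)\}f(y|\theta)\,dy<\infty.$$ $g(\theta)$ is continuously differentiable in $\theta$, $\nabla_\theta g(\theta_0)>0$, and $\sup_{\theta\in\mathcal{N}}\|\nabla_\theta g(\theta)\|<\infty$. *)

theory Defs
  imports "HOL-Probability.Probability"
begin

text \<open>
  \<open>f y \<theta>\<close> stands for $f(y|\theta)$; it is only meaningful for \<open>y\<close> in the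
  sample space \<open>YY\<close> and \<open>\<theta>\<close> in the parameter space, and the density of \<open>Y\<close> vanishes off \<open>YY\<close>.
\<close>

definition bdry_density ::
  "real set \<Rightarrow> (real \<Rightarrow> real \<Rightarrow> real) \<Rightarrow> (real \<Rightarrow> real) \<Rightarrow> real \<Rightarrow> real \<Rightarrow> real" where
  "bdry_density YY f g \<theta> y = f y \<theta> * indicator {g \<theta>..} y * indicator YY y"

definition bdry_law ::
  "real set \<Rightarrow> (real \<Rightarrow> real \<Rightarrow> real) \<Rightarrow> (real \<Rightarrow> real) \<Rightarrow> real \<Rightarrow> real measure" where
  "bdry_law YY f g \<theta> = density lborel (\<lambda>y. ennreal (bdry_density YY f g \<theta> y))"

text \<open>Joint law of \<open>n\<close> i.i.d. observations at the local parameter \<open>\<theta>\<^sub>0 + h/n\<close>. It is a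
  probability measure once \<open>n\<close> is so large that \<open>\<theta>\<^sub>0 + h/n\<close> lies in the parameter space; only
  such \<open>n\<close> matter for the limits below.\<close>

definition local_law ::
  "real set \<Rightarrow> (real \<Rightarrow> real \<Rightarrow> real) \<Rightarrow> (real \<Rightarrow> real) \<Rightarrow> real \<Rightarrow> nat \<Rightarrow> real \<Rightarrow> (nat \<Rightarrow> real) measure" where
  "local_law YY f g \<theta>\<^sub>0 n h = Pi\<^sub>M {..<n} (\<lambda>_. bdry_law YY f g (\<theta>\<^sub>0 + h / real n))"

text \<open>
  \<open>f\<^sub>1\<close>, \<open>f\<^sub>2\<close> are the first and second derivatives of \<open>f\<close> in \<open>\<theta>\<close>, and \<open>g\<^sub>1\<close> is the derivative of
  \<open>g\<close>. Derivatives are taken within \<open>\<Theta>\<close>, which makes a difference only at end points of \<open>\<Theta>\<close>.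
  The suprema are formed in \<^typ>\<open>ennreal\<close>, so that an infinite supremum is not silently
  replaced by a junk value.
  The assumption \<open>g_in\<close> says that the boundary point itself belongs to the sample space, so
  that $f(g(\theta)|\theta)$ is meaningful; it is automatic for \<open>YY = UNIV\<close>.
\<close>

locale boundary_model =
  fixes YY :: "real set" and \<Theta> :: "real set" and \<theta>\<^sub>0 :: real and H :: "real set"
    and f f\<^sub>1 f\<^sub>2 :: "real \<Rightarrow> real \<Rightarrow> real" and g g\<^sub>1 :: "real \<Rightarrow> real"
    and N :: "real set" and C :: real
  assumes YY_borel: "YY \<in> sets borel"
    and density_measurable: "\<theta> \<in> \<Theta> \<Longrightarrow> bdry_density YY f g \<theta> \<in> borel_measurable lborel"
    and density_nonneg: "\<theta> \<in> \<Theta> \<Longrightarrow> 0 \<le> bdry_density YY f g \<theta> y"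
    and density_total: "\<theta> \<in> \<Theta> \<Longrightarrow> (\<integral>\<^sup>+ y. ennreal (bdry_density YY f g \<theta> y) \<partial>lborel) = 1"
    and Theta_convex: "convex \<Theta>"
    and theta0_interior: "\<theta>\<^sub>0 \<in> interior \<Theta>"
    and zero_in_H: "0 \<in> H"
    and f_deriv: "\<lbrakk>y \<in> YY; \<theta> \<in> \<Theta>\<rbrakk> \<Longrightarrow> (f y has_real_derivative f\<^sub>1 y \<theta>) (at \<theta> within \<Theta>)"
    and f_deriv2: "\<lbrakk>y \<in> YY; \<theta> \<in> \<Theta>\<rbrakk> \<Longrightarrow> (f\<^sub>1 y has_real_derivative f\<^sub>2 y \<theta>) (at \<theta> within \<Theta>)"
    and f_deriv2_cont: "y \<in> YY \<Longrightarrow> continuous_on \<Theta> (f\<^sub>2 y)"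
    and N_open: "open N" and theta0_in_N: "\<theta>\<^sub>0 \<in> N" and N_subset: "N \<subseteq> \<Theta>"
    and f_cont_y: "\<theta> \<in> N \<Longrightarrow> continuous_on YY (\<lambda>y. f y \<theta>)"
    and f_deriv_cont_y: "\<theta> \<in> N \<Longrightarrow> continuous_on YY (\<lambda>y. f\<^sub>1 y \<theta>)"
    and f_pos: "\<lbrakk>y \<in> YY; \<theta> \<in> N\<rbrakk> \<Longrightarrow> 0 < f y \<theta>"
    and f_less: "\<lbrakk>y \<in> YY; \<theta> \<in> N\<rbrakk> \<Longrightarrow> f y \<theta> < C"
    and f_deriv_less: "\<lbrakk>y \<in> YY; \<theta> \<in> N\<rbrakk> \<Longrightarrow> \<bar>f\<^sub>1 y \<theta>\<bar> < C"
    and int_deriv: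
      "(\<integral>\<^sup>+ y \<in> YY. (SUP \<theta>\<in>N. ennreal (\<bar>f\<^sub>1 y \<theta>\<bar> * indicator {g \<theta>..} y)) \<partial>lborel) < \<infinity>"
    and int_score_sq:
      "(\<integral>\<^sup>+ y \<in> YY. (SUP \<theta>\<in>N. SUP \<theta>'\<in>N.
          ennreal (\<bar>f\<^sub>1 y \<theta>'\<bar>\<^sup>2 / (f y \<theta>')\<^sup>2 * indicator {g \<theta>..} y * f y \<theta>)) \<partial>lborel) < \<infinity>"
    and int_deriv2:
      "(\<integral>\<^sup>+ y \<in> YY. (SUP \<theta>\<in>N. SUP \<theta>'\<in>N.
          ennreal (\<bar>f\<^sub>2 y \<theta>'\<bar> / f y \<theta>' * indicator {g \<theta>..} y * f y \<theta>)) \<partial>lborel) < \<infinity>"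
    and g_in: "\<theta> \<in> N \<Longrightarrow> g \<theta> \<in> YY"
    and g_deriv: "\<theta> \<in> \<Theta> \<Longrightarrow> (g has_real_derivative g\<^sub>1 \<theta>) (at \<theta> within \<Theta>)"
    and g_deriv_cont: "continuous_on \<Theta> g\<^sub>1"
    and g_deriv_pos: "0 < g\<^sub>1 \<theta>\<^sub>0"
    and g_deriv_bdd: "bdd_above ((\<lambda>\<theta>. \<bar>g\<^sub>1 \<theta>\<bar>) ` N)"

text \<open>A test based on \<open>n\<close> observations is a function on \<open>\<real>\<^sup>n\<close>, represented by functions on
  \<open>{..<n}\<close>. The size \<open>n = 0\<close> is excluded, as there \<open>h / n\<close> and the sample minimum are meaningless.\<close>

definition test_seq :: "(nat \<Rightarrow> (nat \<Rightarrow> real) \<Rightarrow> real) \<Rightarrow> bool" where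
  "test_seq \<psi> \<longleftrightarrow> (\<forall>n\<ge>1. \<psi> n \<in> borel_measurable (Pi\<^sub>M {..<n} (\<lambda>_. borel)) \<and>
     (\<forall>y \<in> space (Pi\<^sub>M {..<n} (\<lambda>_. borel :: real measure)). 0 \<le> \<psi> n y \<and> \<psi> n y \<le> 1))"

definition asymp_level ::
  "(nat \<Rightarrow> real \<Rightarrow> (nat \<Rightarrow> real) measure) \<Rightarrow> real set \<Rightarrow> real \<Rightarrow> (nat \<Rightarrow> (nat \<Rightarrow> real) \<Rightarrow> real) \<Rightarrow> bool" where
  "asymp_level P H0 \<alpha> \<psi> \<longleftrightarrow>
     (\<forall>h\<in>H0. limsup (\<lambda>n. ereal (\<integral>y. \<psi> n y \<partial>P n h)) \<le> ereal \<alpha>)"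

definition aump ::
  "(nat \<Rightarrow> real \<Rightarrow> (nat \<Rightarrow> real) measure) \<Rightarrow> real set \<Rightarrow> real set \<Rightarrow> real
     \<Rightarrow> (nat \<Rightarrow> (nat \<Rightarrow> real) \<Rightarrow> real) \<Rightarrow> bool" where
  "aump P H0 H1 \<alpha> \<phi> \<longleftrightarrow> test_seq \<phi> \<and> asymp_level P H0 \<alpha> \<phi> \<and>
     (\<forall>\<psi>. test_seq \<psi> \<longrightarrow> asymp_level P H0 \<alpha> \<psi> \<longrightarrow>
       (\<forall>h\<in>H1. limsup (\<lambda>n. ereal (\<integral>y. \<psi> n y \<partial>P n h))
                \<le> liminf (\<lambda>n. ereal (\<integral>y. \<phi> n y \<partial>P n h))))"

definition phi_minus ::
  "(real \<Rightarrow> real) \<Rightarrow> real \<Rightarrow> real \<Rightarrow> real \<Rightarrow> nat \<Rightarrow> (nat \<Rightarrow> real) \<Rightarrow> real" where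
  "phi_minus g \<theta>\<^sub>0 lam \<alpha> n y =
     (if Min (y ` {..<n}) > g (\<theta>\<^sub>0 + lam / real n * ln (1 / \<alpha>)) then 1 else 0)"

end

theory Submission
  imports Defs
begin

text \<open>
  Write \<open>r = f(g(\<theta>\<^sub>0)|\<theta>\<^sub>0) g'(\<theta>\<^sub>0)\<close>, so that \<open>\<lambda> = 1/r\<close>. Seen at the scale \<open>1/n\<close>, the
  experiment is a shifted exponential: under \<open>h\<close> the minimum exceeds \<open>g(\<theta>\<^sub>0 + t/n)\<close> with
  probability tending to \<open>exp (- r(t - h))\<close> for \<open>t \<ge> h\<close> and to 1 for \<open>t < h\<close>. With
  \<open>t = \<lambda> ln (1/\<alpha>)\<close> the rejection probability of the minimum test therefore tends to
  \<open>min 1 (\<alpha> e\<^sup>r\<^sup>h)\<close> for every \<open>h\<close>, negative ones included (\<open>phi_minus_power_limit\<close>); in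
  particular the asymptotic level is at most \<open>\<alpha>\<close>.

  Against a given \<open>h > 0\<close> the least favourable null value is \<open>h = 0\<close>, and no test of it does
  better. The likelihood ratio \<open>L\<^sub>n\<close> of \<open>h\<close> to 0 is 0 when an observation lies below
  \<open>g(\<theta>\<^sub>0 + h/n)\<close>, and otherwise it is close to the constant \<open>e\<^sup>r\<^sup>h\<close>. The upper half of this
  suffices: if \<open>c > e\<^sup>r\<^sup>h\<close>, then \<open>L\<^sub>n \<le> c\<close> with probability tending to 1 under \<open>h\<close>
  (\<open>likelihood_ratio_tail\<close>). A test of level \<open>\<alpha>\<close> then has asymptotic power at most \<open>c \<alpha>\<close>, since
  \<open>E\<^sub>h \<psi> \<le> c E\<^sub>0 \<psi> + P\<^sub>h(L\<^sub>n > c)\<close>; letting \<open>c\<close> decrease to \<open>e\<^sup>r\<^sup>h\<close> and using \<open>\<psi> \<le> 1\<close> gives the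
  bound \<open>min 1 (\<alpha> e\<^sup>r\<^sup>h)\<close> (\<open>asymptotic_power_bound\<close>), which the minimum test attains.

  On the support under \<open>h\<close>, \<open>ln L\<^sub>n\<close> is a sum of i.i.d. terms \<open>X = ln (p\<^sub>h/p\<^sub>0)\<close> in the
  densities of one observation, and Chebyshev's inequality controls it once the first two moments
  are known. The second moment is \<open>O(1/n\<^sup>2)\<close>, because by the mean value theorem \<open>X\<close> is \<open>h/n\<close> times a
  score, and squared scores are dominated by an integrable envelope. For the mean, a
  second-order bound on the logarithm gives \<open>E\<^sub>h X \<le> 1 - P\<^sub>0(Y \<ge> g(\<theta>\<^sub>0 + h/n)) + O(1/n\<^sup>2)\<close>. The main
  term is the mass that \<open>P\<^sub>0\<close> puts on the strip between the two boundaries, which is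
  \<open>rh/n + o(1/n)\<close>. This is where the boundary enters the likelihood: the expected score is not 0
  but the density at the boundary times the speed of the boundary, and it is read off here from the
  total mass 1 without differentiating under the integral sign.
\<close>

section \<open>Likelihood ratios and sums on product spaces\<close>

lemma density_PiM_const:
  fixes r :: "'a \<Rightarrow> real"
  assumes "finite I" and M: "prob_space M" and r[measurable]: "r \<in> borel_measurable M"
    and nonneg: "\<And>x. 0 \<le> r x" and Q: "prob_space (density M r)"
  shows "density (Pi\<^sub>M I (\<lambda>_. M)) (\<lambda>y. ennreal (\<Prod>i\<in>I. r (y i))) = Pi\<^sub>M I (\<lambda>_. density M r)"
proof -
  interpret M: prob_space M by fact
  interpret Q: prob_space "density M r" by fact
  interpret PM: product_prob_space "\<lambda>_::'b. M" I
    by (intro product_prob_spaceI M)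
  interpret PQ: product_prob_space "\<lambda>_::'b. density M r" I
    by (intro product_prob_spaceI Q)
  show ?thesis
  proof (rule PQ.PiM_eqI)
    show "finite I" by fact
    show "sets (density (Pi\<^sub>M I (\<lambda>_. M)) (\<lambda>y. ennreal (\<Prod>i\<in>I. r (y i)))) = sets (Pi\<^sub>M I (\<lambda>_. density M r))"
      by (auto intro!: sets_PiM_cong)
  next
    fix A assume A: "\<And>i. i \<in> I \<Longrightarrow> A i \<in> sets (density M r)"
    then have A'[measurable]: "i \<in> I \<Longrightarrow> A i \<in> sets M" for i by simp
    have "emeasure (density (Pi\<^sub>M I (\<lambda>_. M)) (\<lambda>y. ennreal (\<Prod>i\<in>I. r (y i)))) (Pi\<^sub>E I A)
        = (\<integral>\<^sup>+y. ennreal (\<Prod>i\<in>I. r (y i)) * indicator (Pi\<^sub>E I A) y \<partial>Pi\<^sub>M I (\<lambda>_. M))"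
      using \<open>finite I\<close> by (subst emeasure_density) (auto intro!: sets_PiM_I_finite)
    also have "\<dots> = (\<integral>\<^sup>+y. (\<Prod>i\<in>I. ennreal (r (y i)) * indicator (A i) (y i)) \<partial>Pi\<^sub>M I (\<lambda>_. M))"
    proof (intro nn_integral_cong)
      fix y assume "y \<in> space (Pi\<^sub>M I (\<lambda>_. M))"
      then have "indicator (Pi\<^sub>E I A) y = (\<Prod>i\<in>I. indicator (A i) (y i) :: ennreal)"
        using \<open>finite I\<close>
        by (auto simp: indicator_def space_PiM PiE_iff prod_eq_1_iff split: if_splits)
      then show "ennreal (\<Prod>i\<in>I. r (y i)) * indicator (Pi\<^sub>E I A) y
          = (\<Prod>i\<in>I. ennreal (r (y i)) * indicator (A i) (y i))"
        by (simp add: prod.distrib prod_ennreal nonneg)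
    qed
    also have "\<dots> = (\<Prod>i\<in>I. \<integral>\<^sup>+x. ennreal (r x) * indicator (A i) x \<partial>M)"
      using \<open>finite I\<close> by (intro PM.product_nn_integral_prod) auto
    also have "\<dots> = (\<Prod>i\<in>I. emeasure (density M r) (A i))"
      by (intro prod.cong refl) (simp add: emeasure_density)
    finally show "emeasure (density (Pi\<^sub>M I (\<lambda>_. M)) (\<lambda>y. ennreal (\<Prod>i\<in>I. r (y i)))) (Pi\<^sub>E I A)
        = (\<Prod>i\<in>I. emeasure (density M r) (A i))" .
  qed
qed

lemma
  fixes X :: "'a \<Rightarrow> real"
  assumes M: "prob_space M" and i: "i \<in> I" and X: "integrable M X"
  shows integrable_PiM_component: "integrable (Pi\<^sub>M I (\<lambda>_. M)) (\<lambda>y. X (y i))"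
    and integral_PiM_component: "(\<integral>y. X (y i) \<partial>Pi\<^sub>M I (\<lambda>_. M)) = (\<integral>x. X x \<partial>M)"
proof -
  have d: "distr (Pi\<^sub>M I (\<lambda>_. M)) M (\<lambda>y. y i) = M"
    using distr_PiM_component[of I "\<lambda>_. M" i] M i by simp
  have m: "(\<lambda>y. y i) \<in> measurable (Pi\<^sub>M I (\<lambda>_. M)) M" using i by measurable
  show "integrable (Pi\<^sub>M I (\<lambda>_. M)) (\<lambda>y. X (y i))"
    using integrable_distr[OF m, of X] X d by simp
  show "(\<integral>y. X (y i) \<partial>Pi\<^sub>M I (\<lambda>_. M)) = (\<integral>x. X x \<partial>M)"
    using integral_distr[OF m, of X] X d by simp
qed

lemma
  fixes X :: "'a \<Rightarrow> real"
  assumes M: "prob_space M" and I: "finite I" and ij: "i \<in> I" "j \<in> I" "i \<noteq> j"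
    and X: "integrable M X"
  shows integrable_PiM_mult: "integrable (Pi\<^sub>M I (\<lambda>_. M)) (\<lambda>y. X (y i) * X (y j))"
    and integral_PiM_mult: "(\<integral>y. X (y i) * X (y j) \<partial>Pi\<^sub>M I (\<lambda>_. M)) = (\<integral>x. X x \<partial>M)\<^sup>2"
proof -
  interpret M: prob_space M by fact
  interpret PM: product_prob_space "\<lambda>_::'b. M" I
    by (intro product_prob_spaceI M)
  \<comment> \<open>The product of two coordinates as a product over the whole index set.\<close>
  define F where "F k = (if k \<in> {i, j} then X else (\<lambda>_. 1))" for k
  have F: "integrable M (F k)" for k unfolding F_def using X by auto
  have split: "(\<Prod>k\<in>I. G k) = G i * G j * (\<Prod>k\<in>I - {i,j}. G k)" for G :: "'b \<Rightarrow> real"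
  proof -
    have "(\<Prod>k\<in>I. G k) = (\<Prod>k\<in>{i,j}. G k) * (\<Prod>k\<in>I - {i,j}. G k)"
      using ij I by (subst prod.union_disjoint[symmetric]) (auto intro!: prod.cong)
    then show ?thesis using ij by simp
  qed
  have eq: "(\<Prod>k\<in>I. F k (y k)) = X (y i) * X (y j)" for y
    by (subst split) (auto simp: F_def intro!: prod.neutral)
  show "integrable (Pi\<^sub>M I (\<lambda>_. M)) (\<lambda>y. X (y i) * X (y j))"
    using PM.product_integrable_prod[OF I, of F] F eq by simp
  have "(\<integral>y. X (y i) * X (y j) \<partial>Pi\<^sub>M I (\<lambda>_. M)) = (\<Prod>k\<in>I. \<integral>x. F k x \<partial>M)"
    using PM.product_integral_prod[OF I, of F] F eq by simp
  also have "\<dots> = (\<integral>x. X x \<partial>M)\<^sup>2"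
    by (subst split) (auto simp: F_def power2_eq_square M.prob_space intro!: prod.neutral)
  finally show "(\<integral>y. X (y i) * X (y j) \<partial>Pi\<^sub>M I (\<lambda>_. M)) = (\<integral>x. X x \<partial>M)\<^sup>2" .
qed

text \<open>
  Chebyshev's inequality for the sum, whose variance is computed by expanding the square of the
  centred sum: the off-diagonal terms vanish. Bounding the variance of a summand by its second
  moment suffices because the log likelihood ratios have second moments of order \<open>1/n\<^sup>2\<close>.
\<close>

lemma iid_sum_upper_tail:
  fixes X :: "'a \<Rightarrow> real"
  assumes M: "prob_space M" and [measurable]: "X \<in> borel_measurable M"
    and X2: "integrable M (\<lambda>x. (X x)\<^sup>2)" and "0 < \<epsilon>"
  shows "measure (Pi\<^sub>M {..<n} (\<lambda>_. M))
      {y \<in> space (Pi\<^sub>M {..<n} (\<lambda>_. M)). real n * (\<integral>x. X x \<partial>M) + \<epsilon> \<le> (\<Sum>i<n. X (y i))}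
    \<le> real n * (\<integral>x. (X x)\<^sup>2 \<partial>M) / \<epsilon>\<^sup>2" (is "measure ?P ?A \<le> _")
proof -
  interpret M: prob_space M by fact
  interpret P: prob_space ?P by (intro prob_space_PiM M)
  have X: "integrable M X" using M.square_integrable_imp_integrable[of X] X2 by simp
  define Z where "Z x = X x - (\<integral>x. X x \<partial>M)" for x
  have Z[measurable]: "Z \<in> borel_measurable M" unfolding Z_def by measurable
  have intZ: "integrable M Z" unfolding Z_def using X by simp
  have EZ: "(\<integral>x. Z x \<partial>M) = 0" unfolding Z_def using X by (simp add: M.prob_space)
  have intZ2: "integrable M (\<lambda>x. (Z x)\<^sup>2)"
    unfolding Z_def power2_diff using X X2 by (auto intro!: Bochner_Integration.integrable_add Bochner_Integration.integrable_diff)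
  have EZ2: "(\<integral>x. (Z x)\<^sup>2 \<partial>M) \<le> (\<integral>x. (X x)\<^sup>2 \<partial>M)"
    unfolding Z_def using M.variance_eq[OF X X2] by simp
  have sq: "(\<Sum>i<n. Z (y i))\<^sup>2 = (\<Sum>i<n. \<Sum>j<n. Z (y i) * Z (y j))" for y :: "nat \<Rightarrow> 'a"
    by (simp add: power2_eq_square sum_product)
  have int: "integrable ?P (\<lambda>y. Z (y i) * Z (y j))" if "i < n" "j < n" for i j
  proof (cases "i = j")
    case True
    then show ?thesis
      using integrable_PiM_component[OF M, of i "{..<n}", OF _ intZ2] that by (simp add: power2_eq_square)
  next
    case False
    then show ?thesis using integrable_PiM_mult[OF M _ _ _ False intZ] that by simp
  qed
  have E: "(\<integral>y. Z (y i) * Z (y j) \<partial>?P) = (if i = j then \<integral>x. (Z x)\<^sup>2 \<partial>M else 0)" if "i < n" "j < n" for i j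
  proof (cases "i = j")
    case True
    then show ?thesis
      using integral_PiM_component[OF M, of i "{..<n}", OF _ intZ2] that by (simp add: power2_eq_square)
  next
    case False
    then show ?thesis using integral_PiM_mult[OF M _ _ _ False intZ] that EZ by simp
  qed
  have int': "integrable ?P (\<lambda>y. (\<Sum>i<n. Z (y i))\<^sup>2)"
    unfolding sq by (intro Bochner_Integration.integrable_sum int) auto
  have "(\<integral>y. (\<Sum>i<n. Z (y i))\<^sup>2 \<partial>?P) = (\<Sum>i<n. \<Sum>j<n. \<integral>y. Z (y i) * Z (y j) \<partial>?P)"
    unfolding sq by (subst Bochner_Integration.integral_sum
        , auto intro!: int Bochner_Integration.integrable_sum sum.cong Bochner_Integration.integral_sum)
  also have "\<dots> = real n * (\<integral>x. (Z x)\<^sup>2 \<partial>M)"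
    by (simp add: E)
  also have "\<dots> \<le> real n * (\<integral>x. (X x)\<^sup>2 \<partial>M)"
    using EZ2 by (simp add: mult_left_mono)
  finally have var: "(\<integral>y. (\<Sum>i<n. Z (y i))\<^sup>2 \<partial>?P) \<le> real n * (\<integral>x. (X x)\<^sup>2 \<partial>M)" .
  have "?A \<subseteq> {y \<in> space ?P. \<epsilon>\<^sup>2 \<le> (\<Sum>i<n. Z (y i))\<^sup>2}"
    using \<open>0 < \<epsilon>\<close> by (auto simp: Z_def sum_subtractf intro!: power_mono)
  then have "measure ?P ?A \<le> measure ?P {y \<in> space ?P. \<epsilon>\<^sup>2 \<le> (\<Sum>i<n. Z (y i))\<^sup>2}"
    by (intro P.finite_measure_mono) measurable
  also have "\<dots> \<le> (\<integral>y. (\<Sum>i<n. Z (y i))\<^sup>2 \<partial>?P) / \<epsilon>\<^sup>2"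
    using int' \<open>0 < \<epsilon>\<close> by (intro integral_Markov_inequality_measure[where A = "{}"]) auto
  also have "\<dots> \<le> real n * (\<integral>x. (X x)\<^sup>2 \<partial>M) / \<epsilon>\<^sup>2"
    using var by (intro divide_right_mono) auto
  finally show ?thesis .
qed

text \<open>
  The easy half of the Neyman-Pearson lemma. Where the likelihood ratio is at most \<open>c\<close>, changing
  the measure costs a factor of at most \<open>c\<close>; elsewhere the test is bounded by 1.
\<close>

lemma expectation_le_likelihood_bound:
  fixes L \<psi> :: "'a \<Rightarrow> real"
  assumes P: "prob_space P" and [measurable]: "L \<in> borel_measurable P" "\<psi> \<in> borel_measurable P"
    and L0: "\<And>x. 0 \<le> L x" and Q: "prob_space (density P L)"
    and \<psi>: "\<And>x. x \<in> space P \<Longrightarrow> 0 \<le> \<psi> x \<and> \<psi> x \<le> 1" and "0 \<le> c"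
  shows "(\<integral>x. \<psi> x \<partial>density P L) \<le> c * (\<integral>x. \<psi> x \<partial>P) + measure (density P L) {x \<in> space P. c < L x}"
proof -
  interpret P: prob_space P by fact
  interpret Q: prob_space "density P L" by fact
  have "(\<integral>\<^sup>+x. ennreal (L x) \<partial>P) = 1"
    using Q.emeasure_space_1 by (simp add: emeasure_density cong: nn_integral_cong)
  then have intL: "integrable P L"
    using L0 by (intro integrableI_nonneg) auto
  have int\<psi>: "integrable P \<psi>"
    using \<psi> by (intro P.integrable_const_bound[where B = 1]) auto
  have intL\<psi>: "integrable P (\<lambda>x. L x * \<psi> x)"
    using \<psi> L0 by (intro Bochner_Integration.integrable_bound[OF intL]) (auto simp: abs_mult intro!: AE_I2 mult_left_le)
  have intLI: "integrable P (\<lambda>x. L x * indicator {x \<in> space P. c < L x} x)"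
    using L0 by (intro Bochner_Integration.integrable_bound[OF intL]) (auto simp: indicator_def)
  have "(\<integral>x. \<psi> x \<partial>density P L) = (\<integral>x. L x * \<psi> x \<partial>P)"
    using L0 by (subst integral_density) auto
  also have "\<dots> \<le> (\<integral>x. c * \<psi> x + L x * indicator {x \<in> space P. c < L x} x \<partial>P)"
  proof (intro integral_mono intL\<psi> Bochner_Integration.integrable_add intLI)
    show "integrable P (\<lambda>x. c * \<psi> x)" using int\<psi> by simp
    fix x assume x: "x \<in> space P"
    show "L x * \<psi> x \<le> c * \<psi> x + L x * indicator {x \<in> space P. c < L x} x"
    proof (cases "c < L x")
      case True
      have "L x * \<psi> x \<le> L x" using \<psi>[OF x] L0[of x] by (simp add: mult_left_le)
      moreover have "0 \<le> c * \<psi> x" using \<psi>[OF x] \<open>0 \<le> c\<close> by simp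
      ultimately show ?thesis using x True by simp
    next
      case False
      then show ?thesis using \<psi>[OF x] by (auto intro!: mult_right_mono)
    qed
  qed
  also have "\<dots> = c * (\<integral>x. \<psi> x \<partial>P) + (\<integral>x. L x * indicator {x \<in> space P. c < L x} x \<partial>P)"
    using int\<psi> intLI by simp
  also have "(\<integral>x. L x * indicator {x \<in> space P. c < L x} x \<partial>P)
      = (\<integral>x. indicator {x \<in> space P. c < L x} x \<partial>density P L)"
    using L0 by (subst integral_density) auto
  also have "\<dots> = measure (density P L) {x \<in> space P. c < L x}"
    by (simp add: Int_absorb2)
  finally show ?thesis .
qed

section \<open>Elementary limits and inequalities\<close>

text \<open>
  The limit \<open>(1 - a/n)\<^sup>n \<rightarrow> e\<^sup>-\<^sup>a\<close> survives a perturbation of \<open>a\<close>, because on the unit interval the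
  \<open>n\<close>-th power is Lipschitz with constant \<open>n\<close>.
\<close>

lemma tendsto_one_minus_power:
  fixes m :: "nat \<Rightarrow> real"
  assumes m: "(\<lambda>n. real n * m n) \<longlonglongrightarrow> a" and m01: "\<forall>\<^sub>F n in sequentially. 0 \<le> m n \<and> m n \<le> 1"
    and "0 \<le> a"
  shows "(\<lambda>n. (1 - m n) ^ n) \<longlonglongrightarrow> exp (- a)"
proof -
  have "(\<lambda>n. (1 - m n) ^ n - (1 + (- a) / real n) ^ n) \<longlonglongrightarrow> 0"
  proof (rule Lim_null_comparison)
    show "(\<lambda>n. \<bar>real n * m n - a\<bar>) \<longlonglongrightarrow> 0"
      using tendsto_rabs[OF tendsto_diff[OF m tendsto_const[of a]]] by simp
    show "\<forall>\<^sub>F n in sequentially. norm ((1 - m n) ^ n - (1 + (- a) / real n) ^ n) \<le> \<bar>real n * m n - a\<bar>"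
      using m01 eventually_ge_at_top[of "nat \<lceil>a\<rceil>"] eventually_gt_at_top[of 0]
    proof eventually_elim
      case (elim n)
      then have "a \<le> real n" by linarith
      then have "0 \<le> a / real n" "a / real n \<le> 1" using \<open>0 \<le> a\<close> elim by auto
      then have "norm ((1 - m n) ^ n - (1 + (- a) / real n) ^ n) \<le> real n * norm ((1 - m n) - (1 + (- a) / real n))"
        using elim by (intro norm_power_diff) auto
      also have "\<dots> = \<bar>real n * ((1 - m n) - (1 + (- a) / real n))\<bar>" by (simp add: abs_mult)
      also have "real n * ((1 - m n) - (1 + (- a) / real n)) = - (real n * m n - a)"
        using elim by (simp add: algebra_simps)
      finally show ?case by simp
    qed
  qed
  from tendsto_add[OF this tendsto_exp_limit_sequentially[of "- a"]] show ?thesis by simp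
qed

lemma local_parameter_tendsto: "(\<lambda>n. \<theta> + h / real n) \<longlonglongrightarrow> \<theta>"
  using tendsto_add[OF tendsto_const lim_const_over_n[of h]] by simp

lemma Min_image_lessThan_gt_iff:
  fixes y :: "nat \<Rightarrow> real"
  assumes "1 \<le> n"
  shows "b < Min (y ` {..<n}) \<longleftrightarrow> (\<forall>i<n. b < y i)"
  using assms by (subst Min_gr_iff) (auto simp: lessThan_empty_iff)

text \<open>
  For \<open>x = ln (q/p)\<close> this reads, after multiplication by \<open>q\<close>: the contribution \<open>q x\<close> to the relative
  entropy is at most \<open>q - p\<close> up to \<open>x\<^sup>2 q + x\<^sup>2 p\<close>. Having both \<open>q\<close> and \<open>p\<close> in the error term is what
  makes the inequality global: when \<open>q\<close> is much smaller than \<open>p\<close>, the deficit \<open>p - q\<close> is paid for by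
  \<open>x\<^sup>2 p\<close>. It follows from \<open>e\<^sup>x \<ge> 1 + x\<close>, separately for the two signs of \<open>x\<close>.
\<close>

lemma log_le_density_deficit:
  fixes x :: real
  shows "x \<le> 1 - exp (- x) + x\<^sup>2 + x\<^sup>2 * exp (- x)"
proof (cases "0 \<le> x")
  case True
  have "1 + x \<le> exp x" by (rule exp_ge_add_one_self)
  then have "1 \<le> exp x * (1 - x + x\<^sup>2)"
  proof -
    have "1 \<le> (1 + x) * (1 - x + x\<^sup>2)"
      using True by (simp add: algebra_simps power2_eq_square)
    also have "\<dots> \<le> exp x * (1 - x + x\<^sup>2)"
    proof (rule mult_right_mono[OF \<open>1 + x \<le> exp x\<close>])
      have "1 - x + x\<^sup>2 = (x - 1/2)\<^sup>2 + 3/4" by (simp add: power2_eq_square algebra_simps)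
      then show "0 \<le> 1 - x + x\<^sup>2" by simp
    qed
    finally show ?thesis .
  qed
  then have "exp (- x) \<le> 1 - x + x\<^sup>2"
    by (simp add: exp_minus field_simps)
  then show ?thesis by (simp add: add_increasing2)
next
  case False
  have "exp x \<ge> 1 + x" by (rule exp_ge_add_one_self)
  then have "(1 - x) * (1 + x) \<le> (1 - x) * exp x" using False by (intro mult_left_mono) auto
  then have "1 - (1 - x) * exp x \<le> x\<^sup>2" by (simp add: power2_eq_square algebra_simps)
  then have "(1 - (1 - x) * exp x) * exp (- x) \<le> x\<^sup>2 * exp (- x)" by (intro mult_right_mono) auto
  moreover have "exp x * exp (- x) = 1" by (simp add: exp_add[symmetric])
  then have "(1 - (1 - x) * exp x) * exp (- x) = exp (- x) - (1 - x)" by (simp add: algebra_simps)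
  ultimately show ?thesis by (smt (verit) zero_le_power2)
qed

section \<open>The model near the boundary\<close>

context boundary_model
begin

abbreviation dens :: "real \<Rightarrow> real \<Rightarrow> real" where "dens \<equiv> bdry_density YY f g"

abbreviation law :: "real \<Rightarrow> real measure" where "law \<equiv> bdry_law YY f g"

text \<open>
  The rate of the limiting exponential law of the rescaled minimum, the reciprocal of \<open>\<lambda>\<close>.
\<close>

definition rate :: real where "rate = f (g \<theta>\<^sub>0) \<theta>\<^sub>0 * g\<^sub>1 \<theta>\<^sub>0"

lemma rate_pos: "0 < rate"
  unfolding rate_def using f_pos g_in theta0_in_N g_deriv_pos by (intro mult_pos_pos) auto

lemma g_DERIV: "(g has_real_derivative g\<^sub>1 \<theta>) (at \<theta>)" if "\<theta> \<in> N"
proof -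
  have "\<theta> \<in> interior \<Theta>" using that N_open N_subset interior_maximal by blast
  then show ?thesis using g_deriv[of \<theta>] that N_subset at_within_interior[of \<theta> \<Theta>] by auto
qed

lemma f_DERIV: "(f y has_real_derivative f\<^sub>1 y \<theta>) (at \<theta>)" if "y \<in> YY" "\<theta> \<in> N"
proof -
  have "\<theta> \<in> interior \<Theta>" using that N_open N_subset interior_maximal by blast
  then show ?thesis using f_deriv[of y \<theta>] that N_subset at_within_interior[of \<theta> \<Theta>] by auto
qed

lemma eventually_local_parameter: "\<forall>\<^sub>F n in sequentially. \<theta>\<^sub>0 + h / real n \<in> N"
  by (rule topological_tendstoD[OF local_parameter_tendsto N_open theta0_in_N])

lemma eventually_local_segment:
  "\<forall>\<^sub>F n in sequentially. {\<theta>\<^sub>0..\<theta>\<^sub>0 + h / real n} \<subseteq> N"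
proof -
  obtain d where d: "0 < d" "ball \<theta>\<^sub>0 d \<subseteq> N"
    using N_open theta0_in_N open_contains_ball by blast
  have "\<forall>\<^sub>F n in sequentially. \<theta>\<^sub>0 + h / real n < \<theta>\<^sub>0 + d"
    by (rule order_tendstoD[OF local_parameter_tendsto]) (use d in auto)
  then show ?thesis
  proof eventually_elim
    case (elim n)
    then have "{\<theta>\<^sub>0..\<theta>\<^sub>0 + h / real n} \<subseteq> ball \<theta>\<^sub>0 d" by (auto simp: dist_real_def)
    then show ?case using d by blast
  qed
qed

lemma dens_borel [measurable]: "\<theta> \<in> \<Theta> \<Longrightarrow> dens \<theta> \<in> borel_measurable borel"
  using density_measurable by simp

lemma sets_law [simp, measurable_cong]: "sets (law \<theta>) = sets borel"
  by (simp add: bdry_law_def)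

lemma space_law [simp]: "space (law \<theta>) = UNIV"
  by (simp add: bdry_law_def)

lemma prob_space_law: "\<theta> \<in> \<Theta> \<Longrightarrow> prob_space (law \<theta>)"
  by (rule prob_spaceI) (simp add: bdry_law_def emeasure_density density_total)

lemma integrable_dens:
  assumes "\<theta> \<in> \<Theta>" shows "integrable lborel (dens \<theta>)"
  using assms density_nonneg density_total[OF assms] by (intro integrableI_nonneg) auto

lemma measure_law:
  assumes "\<theta> \<in> \<Theta>" "A \<in> sets borel"
  shows "measure (law \<theta>) A = (\<integral>y. dens \<theta> y * indicator A y \<partial>lborel)"
proof -
  have "measure (law \<theta>) A = (\<integral>y. indicator A y \<partial>law \<theta>)" by simp
  also have "\<dots> = (\<integral>y. dens \<theta> y * indicator A y \<partial>lborel)"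
    unfolding bdry_law_def using assms density_nonneg by (subst integral_density) auto
  finally show ?thesis .
qed

lemma g_local_slope: "(\<lambda>n. real n * (g (\<theta>\<^sub>0 + t / real n) - g \<theta>\<^sub>0)) \<longlonglongrightarrow> g\<^sub>1 \<theta>\<^sub>0 * t"
proof (cases "t = 0")
  case False
  have "((\<lambda>k. (g (\<theta>\<^sub>0 + k) - g \<theta>\<^sub>0) / k) \<longlongrightarrow> g\<^sub>1 \<theta>\<^sub>0) (at 0)"
    using g_DERIV[OF theta0_in_N] by (simp add: DERIV_def)
  moreover have "filterlim (\<lambda>n. t / real n) (at 0) sequentially"
    unfolding filterlim_at using False
    by (auto intro!: lim_const_over_n eventually_mono[OF eventually_gt_at_top[of 0]])
  ultimately have "(\<lambda>n. (g (\<theta>\<^sub>0 + t / real n) - g \<theta>\<^sub>0) / (t / real n)) \<longlonglongrightarrow> g\<^sub>1 \<theta>\<^sub>0"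
    by (rule filterlim_compose)
  from tendsto_mult_right[OF this, of t]
  show ?thesis
    by (rule Lim_transform_eventually)
       (auto simp: False field_simps intro!: eventually_mono[OF eventually_gt_at_top[of 0]])
qed simp

lemma g_local_width:
  "(\<lambda>n. real n * (g (\<theta>\<^sub>0 + t / real n) - g (\<theta>\<^sub>0 + s / real n))) \<longlonglongrightarrow> g\<^sub>1 \<theta>\<^sub>0 * (t - s)"
  using tendsto_diff[OF g_local_slope[of t] g_local_slope[of s]] by (simp add: algebra_simps)

lemma g_local_strict_mono:
  assumes "s < t"
  shows "\<forall>\<^sub>F n in sequentially. g (\<theta>\<^sub>0 + s / real n) < g (\<theta>\<^sub>0 + t / real n)"
proof -
  have "\<forall>\<^sub>F n in sequentially. 0 < real n * (g (\<theta>\<^sub>0 + t / real n) - g (\<theta>\<^sub>0 + s / real n))"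
    using assms g_deriv_pos by (intro order_tendstoD[OF g_local_width]) auto
  then show ?thesis by eventually_elim (auto simp: zero_less_mult_iff)
qed

lemma g_local_mono:
  assumes "s \<le> t"
  shows "\<forall>\<^sub>F n in sequentially. g (\<theta>\<^sub>0 + s / real n) \<le> g (\<theta>\<^sub>0 + t / real n)"
  using g_local_strict_mono[of s t] assms by (cases "s = t") (auto elim: eventually_mono)

lemma g_local_tendsto: "(\<lambda>n. g (\<theta>\<^sub>0 + t / real n)) \<longlonglongrightarrow> g \<theta>\<^sub>0"
  using DERIV_isCont[OF g_DERIV[OF theta0_in_N]] local_parameter_tendsto
  by (rule isCont_tendsto_compose)

text \<open>
  The sample space is an arbitrary Borel set, but it contains the image of a neighbourhood of \<open>\<theta>\<^sub>0\<close>
  under \<open>g\<close>. As \<open>g\<close> is continuous and increases strictly through \<open>\<theta>\<^sub>0\<close>, the intermediate value theorem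
  makes this image a neighbourhood of \<open>g \<theta>\<^sub>0\<close>.
\<close>

lemma sample_space_nbhd: "\<forall>\<^sub>F y in nhds (g \<theta>\<^sub>0). y \<in> YY"
proof -
  have ev: "\<forall>\<^sub>F n in sequentially. g (\<theta>\<^sub>0 + (-1) / real n) < g (\<theta>\<^sub>0 + 0 / real n) \<and>
      g (\<theta>\<^sub>0 + 0 / real n) < g (\<theta>\<^sub>0 + 1 / real n) \<and>
      {\<theta>\<^sub>0 + (-1) / real n..\<theta>\<^sub>0 + 1 / real n} \<subseteq> N"
  proof (intro eventually_conj g_local_strict_mono)
    obtain d where d: "0 < d" "ball \<theta>\<^sub>0 d \<subseteq> N"
      using N_open theta0_in_N open_contains_ball by blast
    have "\<forall>\<^sub>F n in sequentially. \<theta>\<^sub>0 + 1 / real n < \<theta>\<^sub>0 + d"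
      by (rule order_tendstoD[OF local_parameter_tendsto]) (use d in auto)
    then show "\<forall>\<^sub>F n in sequentially. {\<theta>\<^sub>0 + (-1) / real n..\<theta>\<^sub>0 + 1 / real n} \<subseteq> N"
    proof eventually_elim
      case (elim n)
      then have "{\<theta>\<^sub>0 + (-1) / real n..\<theta>\<^sub>0 + 1 / real n} \<subseteq> ball \<theta>\<^sub>0 d" by (auto simp: dist_real_def)
      then show ?case using d by blast
    qed
  qed auto
  obtain n where n: "g (\<theta>\<^sub>0 + (-1) / real n) < g \<theta>\<^sub>0" "g \<theta>\<^sub>0 < g (\<theta>\<^sub>0 + 1 / real n)"
      "{\<theta>\<^sub>0 + (-1) / real n..\<theta>\<^sub>0 + 1 / real n} \<subseteq> N"
    using eventually_happens[OF ev] by auto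
  have "y \<in> YY" if y: "y \<in> {g (\<theta>\<^sub>0 + (-1) / real n)<..<g (\<theta>\<^sub>0 + 1 / real n)}" for y
  proof -
    have "\<exists>x\<ge>\<theta>\<^sub>0 + (-1) / real n. x \<le> \<theta>\<^sub>0 + 1 / real n \<and> g x = y"
      using y n by (intro IVT) (auto intro!: DERIV_isCont[OF g_DERIV])
    then show ?thesis using n g_in by auto
  qed
  then show ?thesis
    using n by (intro eventually_nhds_in_open[THEN eventually_mono,
        of "{g (\<theta>\<^sub>0 + (-1) / real n)<..<g (\<theta>\<^sub>0 + 1 / real n)}"]) auto
qed

lemma f_Lipschitz:
  assumes "y \<in> YY" "closed_segment a b \<subseteq> N"
  shows "\<bar>f y b - f y a\<bar> \<le> C * \<bar>b - a\<bar>"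
proof -
  have "norm (f y b - f y a) \<le> C * norm (b - a)"
  proof (rule field_differentiable_bound[of "closed_segment a b" "f y" "f\<^sub>1 y"])
    fix z assume "z \<in> closed_segment a b"
    then have "z \<in> N" using assms by auto
    then show "(f y has_field_derivative f\<^sub>1 y z) (at z within closed_segment a b)"
      using f_DERIV[OF assms(1)] DERIV_subset by blast
    show "norm (f\<^sub>1 y z) \<le> C" using f_deriv_less[OF assms(1) \<open>z \<in> N\<close>] by simp
  qed auto
  then show ?thesis by simp
qed

text \<open>
  Continuity in \<open>y\<close> at \<open>\<theta>\<^sub>0\<close> is combined with the Lipschitz bound in \<open>\<theta>\<close>, which is uniform in \<open>y\<close>.
\<close>

lemma f_jointly_continuous:
  assumes "0 < \<epsilon>"
  obtains d where "0 < d" "\<And>y \<theta>. \<bar>\<theta> - \<theta>\<^sub>0\<bar> < d \<Longrightarrow> \<bar>y - g \<theta>\<^sub>0\<bar> < d \<Longrightarrow>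
    \<theta> \<in> N \<and> y \<in> YY \<and> \<bar>f y \<theta> - f (g \<theta>\<^sub>0) \<theta>\<^sub>0\<bar> \<le> \<epsilon>"
proof -
  obtain d1 where d1: "0 < d1" "ball \<theta>\<^sub>0 d1 \<subseteq> N"
    using N_open theta0_in_N open_contains_ball by blast
  obtain d2 where d2: "0 < d2" "\<And>y. \<bar>y - g \<theta>\<^sub>0\<bar> < d2 \<Longrightarrow> y \<in> YY"
    using sample_space_nbhd unfolding eventually_nhds_metric dist_real_def by auto
  have "g \<theta>\<^sub>0 \<in> YY" using g_in theta0_in_N by auto
  then obtain d3 where d3: "0 < d3" "\<And>y. y \<in> YY \<Longrightarrow> \<bar>y - g \<theta>\<^sub>0\<bar> < d3 \<Longrightarrow> \<bar>f y \<theta>\<^sub>0 - f (g \<theta>\<^sub>0) \<theta>\<^sub>0\<bar> < \<epsilon> / 2"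
    using f_cont_y[OF theta0_in_N] \<open>0 < \<epsilon>\<close> unfolding continuous_on_iff dist_real_def
    by (metis half_gt_zero)
  have "0 < C" using f_pos[OF \<open>g \<theta>\<^sub>0 \<in> YY\<close> theta0_in_N] f_less[OF \<open>g \<theta>\<^sub>0 \<in> YY\<close> theta0_in_N] by linarith
  define d where "d = Min {d1, d2, d3, \<epsilon> / (2 * C)}"
  have d: "d \<le> d1" "d \<le> d2" "d \<le> d3" "d \<le> \<epsilon> / (2 * C)" "0 < d"
    unfolding d_def using d1 d2 d3 \<open>0 < \<epsilon>\<close> \<open>0 < C\<close> by auto
  show thesis
  proof (rule that[OF \<open>0 < d\<close>])
    fix y \<theta> assume \<theta>: "\<bar>\<theta> - \<theta>\<^sub>0\<bar> < d" and y: "\<bar>y - g \<theta>\<^sub>0\<bar> < d"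
    have seg: "closed_segment \<theta>\<^sub>0 \<theta> \<subseteq> N"
      using \<theta> d d1 by (auto simp: closed_segment_eq_real_ivl dist_real_def split: if_splits intro!: subsetD[OF d1(2)])
    have yY: "y \<in> YY" using d2 y d by auto
    have "\<bar>f y \<theta> - f y \<theta>\<^sub>0\<bar> \<le> C * \<bar>\<theta> - \<theta>\<^sub>0\<bar>" by (rule f_Lipschitz[OF yY seg])
    also have "\<dots> \<le> C * (\<epsilon> / (2 * C))" using \<theta> d \<open>0 < C\<close> by (intro mult_left_mono) auto
    also have "\<dots> = \<epsilon> / 2" using \<open>0 < C\<close> by simp
    finally have "\<bar>f y \<theta> - f y \<theta>\<^sub>0\<bar> \<le> \<epsilon> / 2" .
    moreover have "\<bar>f y \<theta>\<^sub>0 - f (g \<theta>\<^sub>0) \<theta>\<^sub>0\<bar> < \<epsilon> / 2" using d3 yY y d by auto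
    ultimately have "\<bar>f y \<theta> - f (g \<theta>\<^sub>0) \<theta>\<^sub>0\<bar> \<le> \<epsilon>" by linarith
    then show "\<theta> \<in> N \<and> y \<in> YY \<and> \<bar>f y \<theta> - f (g \<theta>\<^sub>0) \<theta>\<^sub>0\<bar> \<le> \<epsilon>"
      using seg yY by auto
  qed
qed

lemma mass_near_boundary:
  assumes "\<theta> \<in> \<Theta>" "g \<theta> \<le> b" and near: "\<And>y. g \<theta> \<le> y \<Longrightarrow> y \<le> b \<Longrightarrow> y \<in> YY \<and> \<bar>f y \<theta> - p\<bar> \<le> \<epsilon>"
  shows "\<bar>measure (law \<theta>) {..b} - p * (b - g \<theta>)\<bar> \<le> \<epsilon> * (b - g \<theta>)"
proof -
  have m: "measure (law \<theta>) {..b} = (\<integral>y. dens \<theta> y * indicator {..b} y \<partial>lborel)"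
    by (rule measure_law) (use assms in auto)
  have int: "integrable lborel (\<lambda>y. dens \<theta> y * indicator {..b} y)"
    using integrable_dens[OF assms(1)] by (intro integrable_real_mult_indicator) auto
  have intc: "integrable lborel (\<lambda>y. c * indicator {g \<theta>..b} y)" for c :: real
    using assms by (intro integrable_mult_right integrable_real_indicator) auto
  have c: "(\<integral>y. c * indicator {g \<theta>..b} y \<partial>lborel) = c * (b - g \<theta>)" for c :: real
    using assms by simp
  have "dens \<theta> y * indicator {..b} y \<le> (p + \<epsilon>) * indicator {g \<theta>..b} y" for y
    using near[of y] by (auto simp: bdry_density_def indicator_def abs_le_iff)
  then have "(\<integral>y. dens \<theta> y * indicator {..b} y \<partial>lborel) \<le> (\<integral>y. (p + \<epsilon>) * indicator {g \<theta>..b} y \<partial>lborel)"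
    by (intro integral_mono int intc)
  moreover have "(p - \<epsilon>) * indicator {g \<theta>..b} y \<le> dens \<theta> y * indicator {..b} y" for y
    using near[of y] density_nonneg[OF assms(1), of y]
    by (auto simp: bdry_density_def indicator_def abs_le_iff split: if_splits)
  then have "(\<integral>y. (p - \<epsilon>) * indicator {g \<theta>..b} y \<partial>lborel) \<le> (\<integral>y. dens \<theta> y * indicator {..b} y \<partial>lborel)"
    by (intro integral_mono int intc)
  ultimately show ?thesis unfolding c m by (simp add: algebra_simps)
qed

text \<open>
  The strip between the boundaries at \<open>s\<close> and \<open>t\<close> has width about \<open>g'(\<theta>\<^sub>0)(t - s)/n\<close>, and the density
  on it is nearly constant. For \<open>s = h\<close> this yields the limit law of the minimum, for \<open>s = 0\<close> the
  mean of the log likelihood ratio.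
\<close>

lemma local_boundary_mass:
  assumes "s \<le> t"
  shows "(\<lambda>n. real n * measure (law (\<theta>\<^sub>0 + s / real n)) {..g (\<theta>\<^sub>0 + t / real n)}) \<longlonglongrightarrow> rate * (t - s)"
proof -
  define w where "w n = g (\<theta>\<^sub>0 + t / real n) - g (\<theta>\<^sub>0 + s / real n)" for n
  define m where "m n = measure (law (\<theta>\<^sub>0 + s / real n)) {..g (\<theta>\<^sub>0 + t / real n)}" for n
  define p where "p = f (g \<theta>\<^sub>0) \<theta>\<^sub>0"
  define W where "W = g\<^sub>1 \<theta>\<^sub>0 * (t - s)"
  have W: "(\<lambda>n. real n * w n) \<longlonglongrightarrow> W" unfolding w_def W_def by (rule g_local_width)
  have W0: "0 \<le> W" unfolding W_def using assms g_deriv_pos by simp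
  have "(\<lambda>n. real n * m n - p * (real n * w n)) \<longlonglongrightarrow> 0"
  proof (rule LIMSEQ_I)
    fix e :: real assume "0 < e"
    \<comment> \<open>The oscillation of the density is multiplied by \<open>n\<close> times the width, which is finally below \<open>W + 1\<close>.\<close>
    define \<epsilon> where "\<epsilon> = e / 2 / (W + 1)"
    have "0 < \<epsilon>" unfolding \<epsilon>_def using \<open>0 < e\<close> W0 by simp
    moreover have "W + 1 \<noteq> 0" using W0 by simp
    then have "e / 2 = \<epsilon> * (W + 1)"
      using nonzero_divide_eq_eq[of "W + 1" "e / 2" \<epsilon>] \<epsilon>_def[symmetric] by blast
    ultimately have \<epsilon>: "0 < \<epsilon>" "\<epsilon> * (W + 1) < e" using \<open>0 < e\<close> by linarith+
    obtain d where d: "0 < d" "\<And>y \<theta>. \<bar>\<theta> - \<theta>\<^sub>0\<bar> < d \<Longrightarrow> \<bar>y - g \<theta>\<^sub>0\<bar> < d \<Longrightarrow>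
        \<theta> \<in> N \<and> y \<in> YY \<and> \<bar>f y \<theta> - p\<bar> \<le> \<epsilon>"
      using f_jointly_continuous[OF \<epsilon>(1)] unfolding p_def by blast
    have e1: "\<forall>\<^sub>F n in sequentially. \<bar>(\<theta>\<^sub>0 + s / real n) - \<theta>\<^sub>0\<bar> < d"
      using tendstoD[OF local_parameter_tendsto[of \<theta>\<^sub>0 s] d(1)] by (simp add: dist_real_def)
    have e2: "\<forall>\<^sub>F n in sequentially. \<bar>g (\<theta>\<^sub>0 + s / real n) - g \<theta>\<^sub>0\<bar> < d"
      using tendstoD[OF g_local_tendsto d(1)] by (simp add: dist_real_def)
    have e3: "\<forall>\<^sub>F n in sequentially. \<bar>g (\<theta>\<^sub>0 + t / real n) - g \<theta>\<^sub>0\<bar> < d"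
      using tendstoD[OF g_local_tendsto d(1)] by (simp add: dist_real_def)
    have e4: "\<forall>\<^sub>F n in sequentially. real n * w n < W + 1"
      by (rule order_tendstoD[OF W]) simp
    have "\<forall>\<^sub>F n in sequentially. norm (real n * m n - p * (real n * w n) - 0) < e"
      using e1 e2 e3 e4 g_local_mono[OF assms] eventually_local_parameter[of s]
    proof eventually_elim
      case (elim n)
      have "\<bar>m n - p * w n\<bar> \<le> \<epsilon> * w n"
        unfolding m_def w_def
      proof (rule mass_near_boundary)
        fix y assume "g (\<theta>\<^sub>0 + s / real n) \<le> y" "y \<le> g (\<theta>\<^sub>0 + t / real n)"
        then have "\<bar>y - g \<theta>\<^sub>0\<bar> < d" using elim by linarith
        then show "y \<in> YY \<and> \<bar>f y (\<theta>\<^sub>0 + s / real n) - p\<bar> \<le> \<epsilon>" using d(2) elim by blast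
      qed (use elim N_subset in auto)
      then have "real n * \<bar>m n - p * w n\<bar> \<le> real n * (\<epsilon> * w n)" by (intro mult_left_mono) auto
      also have "\<dots> = \<epsilon> * (real n * w n)" by simp
      also have "\<dots> \<le> \<epsilon> * (W + 1)" using elim \<epsilon> by (intro mult_left_mono) auto
      also have "\<dots> < e" by (rule \<epsilon>)
      finally have "real n * \<bar>m n - p * w n\<bar> < e" .
      moreover have "norm (real n * m n - p * (real n * w n) - 0) = real n * \<bar>m n - p * w n\<bar>"
        using abs_mult[of "real n" "m n - p * w n"] by (simp add: algebra_simps)
      ultimately show ?case by simp
    qed
    then show "\<exists>no. \<forall>n\<ge>no. norm (real n * m n - p * (real n * w n) - 0) < e"
      by (simp add: eventually_sequentially)
  qed
  from tendsto_add[OF this tendsto_mult_left[OF W, of p]] show ?thesis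
    by (simp add: m_def W_def p_def rate_def mult.assoc)
qed

section \<open>Limiting power of the minimum test\<close>

lemma phi_minus_measurable:
  assumes "1 \<le> n"
  shows "phi_minus g \<theta>\<^sub>0 lam \<alpha> n \<in> borel_measurable (Pi\<^sub>M {..<n} (\<lambda>_. borel))"
proof -
  have eq: "phi_minus g \<theta>\<^sub>0 lam \<alpha> n = (\<lambda>y. if \<forall>i\<in>{..<n}. g (\<theta>\<^sub>0 + lam / real n * ln (1 / \<alpha>)) < y i then 1 else 0)"
    using assms by (auto simp: phi_minus_def Min_image_lessThan_gt_iff fun_eq_iff)
  show ?thesis unfolding eq by measurable
qed

lemma expectation_phi_minus:
  assumes "1 \<le> n" "\<theta>\<^sub>0 + h / real n \<in> \<Theta>"
  shows "(\<integral>y. phi_minus g \<theta>\<^sub>0 lam \<alpha> n y \<partial>local_law YY f g \<theta>\<^sub>0 n h)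
    = (1 - measure (law (\<theta>\<^sub>0 + h / real n)) {..g (\<theta>\<^sub>0 + (lam * ln (1 / \<alpha>)) / real n)}) ^ n"
proof -
  define M where "M = law (\<theta>\<^sub>0 + h / real n)"
  define b where "b = g (\<theta>\<^sub>0 + (lam * ln (1 / \<alpha>)) / real n)"
  interpret M: prob_space M unfolding M_def by (rule prob_space_law) fact
  interpret PM: product_prob_space "\<lambda>_::nat. M" "{..<n}"
    by (intro product_prob_spaceI M.prob_space_axioms)
  interpret PM: finite_product_prob_space "\<lambda>_::nat. M" "{..<n}"
    by unfold_locales auto
  have sM: "sets M = sets borel" "space M = UNIV" by (simp_all add: M_def)
  have "(\<integral>y. phi_minus g \<theta>\<^sub>0 lam \<alpha> n y \<partial>Pi\<^sub>M {..<n} (\<lambda>_. M))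
      = (\<integral>y. indicator (Pi\<^sub>E {..<n} (\<lambda>_. {b<..})) y \<partial>Pi\<^sub>M {..<n} (\<lambda>_. M))"
    using assms
    by (intro Bochner_Integration.integral_cong refl)
       (auto simp: phi_minus_def Min_image_lessThan_gt_iff b_def indicator_def space_PiM PiE_iff sM)
  also have "\<dots> = measure (Pi\<^sub>M {..<n} (\<lambda>_. M)) (Pi\<^sub>E {..<n} (\<lambda>_. {b<..}))"
    by (simp add: Int_absorb2 PiE_mono space_PiM sM)
  also have "\<dots> = (\<Prod>i<n. measure M {b<..})"
    by (rule PM.finite_measure_PiM_emb) (simp add: sM)
  also have "\<dots> = measure M {b<..} ^ n" by simp
  also have "measure M {b<..} = 1 - measure M {..b}"
    using M.prob_compl[of "{..b}"] by (simp add: sM Compl_eq_Diff_UNIV[symmetric])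
  finally show ?thesis by (simp add: local_law_def M_def b_def)
qed

text \<open>
  The test rejects when all \<open>n\<close> observations exceed the threshold, so the rejection probability is the
  \<open>n\<close>-th power of 1 minus the mass below it. For \<open>h > \<lambda> ln (1/\<alpha>)\<close> the threshold finally lies below
  the support and the test rejects with certainty.
\<close>

lemma phi_minus_power_limit:
  assumes "0 < \<alpha>" "\<alpha> < 1"
  shows "(\<lambda>n. \<integral>y. phi_minus g \<theta>\<^sub>0 (inverse rate) \<alpha> n y \<partial>local_law YY f g \<theta>\<^sub>0 n h)
    \<longlonglongrightarrow> min 1 (\<alpha> * exp (rate * h))"
proof -
  define t where "t = inverse rate * ln (1 / \<alpha>)"
  have rt: "rate * t = - ln \<alpha>" unfolding t_def using rate_pos assms by (simp add: ln_div)
  define m where "m n = measure (law (\<theta>\<^sub>0 + h / real n)) {..g (\<theta>\<^sub>0 + t / real n)}" for n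
  have val: "\<alpha> * exp (rate * h) = exp (- (rate * (t - h)))"
    using assms rt by (simp add: algebra_simps exp_add[symmetric]) (simp add: exp_add exp_diff)
  have "(\<lambda>n. (1 - m n) ^ n) \<longlonglongrightarrow> min 1 (\<alpha> * exp (rate * h))"
  proof (cases "h \<le> t")
    case True
    have "(\<lambda>n. (1 - m n) ^ n) \<longlonglongrightarrow> exp (- (rate * (t - h)))"
    proof (rule tendsto_one_minus_power)
      show "(\<lambda>n. real n * m n) \<longlonglongrightarrow> rate * (t - h)"
        unfolding m_def by (rule local_boundary_mass[OF True])
      show "\<forall>\<^sub>F n in sequentially. 0 \<le> m n \<and> m n \<le> 1"
        using eventually_local_parameter[of h]
      proof eventually_elim
        case (elim n)
        then interpret prob_space "law (\<theta>\<^sub>0 + h / real n)"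
          using N_subset by (intro prob_space_law) auto
        show ?case by (simp add: m_def)
      qed
    qed (use True rate_pos in auto)
    moreover have "exp (- (rate * (t - h))) \<le> 1" using True rate_pos by simp
    ultimately show ?thesis unfolding val by (simp only: min_absorb2)
  next
    case False
    then have th: "t < h" by simp
    then have "1 \<le> exp (- (rate * (t - h)))" using rate_pos by (simp add: mult_le_0_iff)
    moreover have "\<forall>\<^sub>F n in sequentially. 1 = (1 - m n) ^ n"
      using g_local_strict_mono[OF th] eventually_local_parameter[of h]
    proof eventually_elim
      case (elim n)
      have z: "dens (\<theta>\<^sub>0 + h / real n) y * indicator {..g (\<theta>\<^sub>0 + t / real n)} y = 0" for y
        using elim by (auto simp: bdry_density_def indicator_def)
      have "m n = (\<integral>y. dens (\<theta>\<^sub>0 + h / real n) y * indicator {..g (\<theta>\<^sub>0 + t / real n)} y \<partial>lborel)"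
        unfolding m_def by (rule measure_law) (use elim N_subset in auto)
      also have "\<dots> = 0" unfolding z by simp
      finally have "m n = 0" .
      then show ?case by simp
    qed
    ultimately show ?thesis
      unfolding val by (simp only: min_absorb1) (rule Lim_transform_eventually[OF tendsto_const])
  qed
  then show ?thesis
  proof (rule Lim_transform_eventually)
    show "\<forall>\<^sub>F n in sequentially. (1 - m n) ^ n = (\<integral>y. phi_minus g \<theta>\<^sub>0 (inverse rate) \<alpha> n y \<partial>local_law YY f g \<theta>\<^sub>0 n h)"
      using eventually_local_parameter[of h] eventually_ge_at_top[of 1]
      by eventually_elim (use N_subset in \<open>auto simp: expectation_phi_minus m_def t_def\<close>)
  qed
qed

section \<open>The log likelihood ratio of one observation\<close>

text \<open>
  Off the support of the density at \<open>b\<close> the ratio is 0, by \<open>0 / 0 = 0\<close> also where both densities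
  vanish; and \<open>ln 0 = 0\<close> makes the logarithm of the ratio vanish there. Statements about the
  logarithm thus need no restriction to the support, and \<open>ratio \<le> exp (ln ratio)\<close> holds everywhere.
\<close>

definition ratio :: "real \<Rightarrow> real \<Rightarrow> real \<Rightarrow> real" where
  "ratio a b y = dens b y / dens a y"

definition score_bound :: real where
  "score_bound = enn2real (\<integral>\<^sup>+ y \<in> YY. (SUP \<theta>\<in>N. SUP \<theta>'\<in>N.
    ennreal (\<bar>f\<^sub>1 y \<theta>'\<bar>\<^sup>2 / (f y \<theta>')\<^sup>2 * indicator {g \<theta>..} y * f y \<theta>)) \<partial>lborel)"

lemma ratio_borel [measurable]: "a \<in> \<Theta> \<Longrightarrow> b \<in> \<Theta> \<Longrightarrow> ratio a b \<in> borel_measurable borel"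
  unfolding ratio_def[abs_def] by measurable

lemma ratio_nonneg: "a \<in> \<Theta> \<Longrightarrow> b \<in> \<Theta> \<Longrightarrow> 0 \<le> ratio a b y"
  unfolding ratio_def using density_nonneg by auto

lemma dens_mult_ratio:
  assumes "a \<in> N" "g a \<le> g b"
  shows "dens a y * ratio a b y = dens b y"
  using f_pos[of y a] assms by (auto simp: ratio_def bdry_density_def indicator_def)

text \<open>
  Moving the boundary to the right shrinks the support, and the densities are positive on their
  supports; hence the law at \<open>b\<close> has a density with respect to the law at \<open>a\<close>.
\<close>

lemma law_eq_density_ratio:
  assumes "a \<in> N" "b \<in> N" "g a \<le> g b"
  shows "law b = density (law a) (ratio a b)"
proof -
  have ab: "a \<in> \<Theta>" "b \<in> \<Theta>" using assms N_subset by auto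
  have "density (law a) (ratio a b) = density lborel (\<lambda>y. ennreal (dens a y) * ennreal (ratio a b y))"
    unfolding bdry_law_def using ab by (intro density_density_eq) auto
  also have "\<dots> = law b"
    unfolding bdry_law_def using ab density_nonneg ratio_nonneg
    by (simp add: ennreal_mult[symmetric] dens_mult_ratio assms)
  finally show ?thesis ..
qed

lemma log_ratio_eq_score:
  assumes "a < b" "{a..b} \<subseteq> N" "g a \<le> g b" "y \<in> YY" "g b \<le> y"
  obtains \<xi> where "\<xi> \<in> N" "ln (ratio a b y) = (b - a) * (f\<^sub>1 y \<xi> / f y \<xi>)"
proof -
  have "\<exists>z>a. z < b \<and> ln (f y b) - ln (f y a) = (b - a) * (f\<^sub>1 y z / f y z)"
  proof (rule MVT2[OF \<open>a < b\<close>])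
    fix x assume "a \<le> x" "x \<le> b"
    then have "x \<in> N" using assms by auto
    then show "((\<lambda>x. ln (f y x)) has_real_derivative f\<^sub>1 y x / f y x) (at x)"
      using f_DERIV[of y x] f_pos[of y x] assms by (auto intro!: derivative_eq_intros)
  qed
  then obtain z where z: "a < z" "z < b" "ln (f y b) - ln (f y a) = (b - a) * (f\<^sub>1 y z / f y z)" by blast
  moreover have "a \<in> N" "b \<in> N" using assms by auto
  then have "ln (ratio a b y) = ln (f y b) - ln (f y a)"
    using f_pos[of y a] f_pos[of y b] assms
    by (simp add: ratio_def bdry_density_def indicator_def ln_div)
  moreover have "z \<in> N" using z assms by auto
  ultimately show thesis using that[of z] by metis
qed

lemma ratio_off_support:
  assumes "\<not> (y \<in> YY \<and> g b \<le> y)" shows "ratio a b y = 0"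
  using assms by (auto simp: ratio_def bdry_density_def indicator_def)

text \<open>
  The second moment is also needed under laws other than that at \<open>b\<close>, as the bound on the mean below
  involves it under the law at \<open>a\<close>. The envelope, a double supremum, is only known through its
  integral and need not be measurable; monotonicity of the integral is all that is used of it.
\<close>

lemma
  assumes ab: "a < b" "{a..b} \<subseteq> N" "g a \<le> g b" and \<theta>: "\<theta> \<in> {a..b}"
  shows integrable_log_ratio_sq: "integrable lborel (\<lambda>y. dens \<theta> y * (ln (ratio a b y))\<^sup>2)"
    and log_ratio_second_moment: "(\<integral>y. dens \<theta> y * (ln (ratio a b y))\<^sup>2 \<partial>lborel) \<le> score_bound * (b - a)\<^sup>2"
proof -
  have in\<Theta>: "a \<in> \<Theta>" "b \<in> \<Theta>" "\<theta> \<in> \<Theta>" and \<theta>N: "\<theta> \<in> N"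
    using subsetD[OF subset_trans[OF ab(2) N_subset]] ab(2) assms(1,4) by auto
  define F where "F y = (SUP \<theta>\<in>N. SUP \<theta>'\<in>N.
    ennreal (\<bar>f\<^sub>1 y \<theta>'\<bar>\<^sup>2 / (f y \<theta>')\<^sup>2 * indicator {g \<theta>..} y * f y \<theta>))" for y
  define Z where "Z y = dens \<theta> y * (ln (ratio a b y))\<^sup>2 / (b - a)\<^sup>2" for y
  have Z0: "0 \<le> Z y" for y unfolding Z_def using density_nonneg in\<Theta> by auto
  have [measurable]: "Z \<in> borel_measurable borel" unfolding Z_def[abs_def] using in\<Theta> by measurable
  have le: "ennreal (Z y) \<le> F y * indicator YY y" for y
  proof (cases "y \<in> YY \<and> g b \<le> y")
    case True
    then obtain \<xi> where \<xi>: "\<xi> \<in> N" "ln (ratio a b y) = (b - a) * (f\<^sub>1 y \<xi> / f y \<xi>)"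
      using log_ratio_eq_score[OF ab] by blast
    have "Z y = \<bar>f\<^sub>1 y \<xi>\<bar>\<^sup>2 / (f y \<xi>)\<^sup>2 * indicator {g \<theta>..} y * f y \<theta>"
      unfolding Z_def \<xi> using ab True
      by (simp add: bdry_density_def power_mult_distrib power_divide)
    also have "ennreal \<dots> \<le> F y"
      unfolding F_def using \<xi> \<theta>N by (intro SUP_upper2[of \<theta>] SUP_upper2[of \<xi>]) auto
    finally show ?thesis using True by simp
  next
    case False
    then show ?thesis unfolding Z_def by (simp add: ratio_off_support)
  qed
  have fin: "(\<integral>\<^sup>+y. F y * indicator YY y \<partial>lborel) < \<infinity>"
    using int_score_sq by (simp add: F_def)
  have "(\<integral>\<^sup>+y. ennreal (Z y) \<partial>lborel) \<le> (\<integral>\<^sup>+y. F y * indicator YY y \<partial>lborel)"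
    by (intro nn_integral_mono le)
  also have "\<dots> = ennreal score_bound"
    using fin by (simp add: score_bound_def F_def)
  finally have nZ: "(\<integral>\<^sup>+y. ennreal (Z y) \<partial>lborel) \<le> ennreal score_bound" .
  then have intZ: "integrable lborel Z"
    using Z0 by (intro integrableI_nonneg) (auto simp: le_less_trans)
  have "ennreal (\<integral>y. Z y \<partial>lborel) \<le> ennreal score_bound"
    using nZ intZ Z0 by (subst nn_integral_eq_integral[symmetric]) auto
  then have Zle: "(\<integral>y. Z y \<partial>lborel) \<le> score_bound"
    by (simp add: score_bound_def)
  have eq: "dens \<theta> y * (ln (ratio a b y))\<^sup>2 = Z y * (b - a)\<^sup>2" for y
    using ab by (simp add: Z_def)
  show "integrable lborel (\<lambda>y. dens \<theta> y * (ln (ratio a b y))\<^sup>2)"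
    unfolding eq using intZ by simp
  show "(\<integral>y. dens \<theta> y * (ln (ratio a b y))\<^sup>2 \<partial>lborel) \<le> score_bound * (b - a)\<^sup>2"
    unfolding eq using Zle by (simp add: mult_right_mono)
qed

text \<open>
  The mean is bounded by integrating \<open>log_le_density_deficit\<close>. Its leading part integrates to
  \<open>1 - P\<^sub>a(Y \<ge> g b) = P\<^sub>a(Y < g b)\<close>, because the density at \<open>b\<close> has total mass 1 and lives on \<open>y \<ge> g b\<close>.
\<close>

lemma
  assumes ab: "a < b" "{a..b} \<subseteq> N" "g a \<le> g b"
  shows law_integrable_log_ratio_sq: "integrable (law b) (\<lambda>y. (ln (ratio a b y))\<^sup>2)"
    and law_log_ratio_second_moment: "(\<integral>y. (ln (ratio a b y))\<^sup>2 \<partial>law b) \<le> score_bound * (b - a)\<^sup>2"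
    and law_log_ratio_mean:
      "(\<integral>y. ln (ratio a b y) \<partial>law b) \<le> measure (law a) {..g b} + 2 * score_bound * (b - a)\<^sup>2"
proof -
  define X where "X y = ln (ratio a b y)" for y
  have inN: "a \<in> N" "b \<in> N" using ab by auto
  then have in\<Theta>: "a \<in> \<Theta>" "b \<in> \<Theta>" using N_subset by auto
  have [measurable]: "X \<in> borel_measurable borel" unfolding X_def[abs_def] using in\<Theta> by measurable
  interpret A: prob_space "law a" by (rule prob_space_law) fact
  interpret B: prob_space "law b" by (rule prob_space_law) fact
  have intA: "integrable lborel (\<lambda>y. dens a y * (X y)\<^sup>2)" and EA: "(\<integral>y. dens a y * (X y)\<^sup>2 \<partial>lborel) \<le> score_bound * (b - a)\<^sup>2"
    using integrable_log_ratio_sq[OF ab, of a] log_ratio_second_moment[OF ab, of a] ab by (auto simp: X_def)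
  have intB: "integrable lborel (\<lambda>y. dens b y * (X y)\<^sup>2)" and EB: "(\<integral>y. dens b y * (X y)\<^sup>2 \<partial>lborel) \<le> score_bound * (b - a)\<^sup>2"
    using integrable_log_ratio_sq[OF ab, of b] log_ratio_second_moment[OF ab, of b] ab by (auto simp: X_def)
  have "integrable (law b) (\<lambda>y. (X y)\<^sup>2)"
    unfolding bdry_law_def using intB in\<Theta> density_nonneg by (subst integrable_density) auto
  then show X2: "integrable (law b) (\<lambda>y. (ln (ratio a b y))\<^sup>2)" by (simp add: X_def)
  have "(\<integral>y. (X y)\<^sup>2 \<partial>law b) = (\<integral>y. dens b y * (X y)\<^sup>2 \<partial>lborel)"
    unfolding bdry_law_def using in\<Theta> density_nonneg by (subst integral_density) auto
  then show "(\<integral>y. (ln (ratio a b y))\<^sup>2 \<partial>law b) \<le> score_bound * (b - a)\<^sup>2" using EB by (simp add: X_def)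
  have X1: "integrable (law b) X"
    using X2 by (intro B.square_integrable_imp_integrable[of X]) (auto simp: X_def)
  have intX: "integrable lborel (\<lambda>y. dens b y * X y)"
    using X1 in\<Theta> density_nonneg unfolding bdry_law_def by (subst (asm) integrable_density) auto
  have inta: "integrable lborel (\<lambda>y. dens a y * indicator {g b..} y)"
    using integrable_dens[OF in\<Theta>(1)] by (intro integrable_real_mult_indicator) auto
  have intb: "integrable lborel (dens b)" using integrable_dens[OF in\<Theta>(2)] .
  have pw: "dens b y * X y \<le> dens b y - dens a y * indicator {g b..} y + dens b y * (X y)\<^sup>2 + dens a y * (X y)\<^sup>2" for y
  proof (cases "y \<in> YY \<and> g b \<le> y")
    case True
    then have pos: "0 < dens a y" "0 < dens b y"
      using f_pos inN ab by (auto simp: bdry_density_def indicator_def)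
    have "exp (- X y) = dens a y / dens b y"
      unfolding X_def using pos by (simp add: exp_minus ratio_def)
    then have s: "dens b y * exp (- X y) = dens a y" using pos by simp
    have "dens b y * X y \<le> dens b y * (1 - exp (- X y) + (X y)\<^sup>2 + (X y)\<^sup>2 * exp (- X y))"
      using pos by (intro mult_left_mono log_le_density_deficit) auto
    also have "\<dots> = dens b y - dens b y * exp (- X y) + dens b y * (X y)\<^sup>2 + dens b y * exp (- X y) * (X y)\<^sup>2"
      by (simp add: algebra_simps)
    finally show ?thesis using True unfolding s by simp
  next
    case False
    then have "X y = 0" by (simp add: X_def ratio_off_support)
    then show ?thesis using False by (auto simp: bdry_density_def indicator_def)
  qed
  have "(\<integral>y. X y \<partial>law b) = (\<integral>y. dens b y * X y \<partial>lborel)"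
    unfolding bdry_law_def using in\<Theta> density_nonneg by (subst integral_density) auto
  also have "\<dots> \<le> (\<integral>y. dens b y - dens a y * indicator {g b..} y + dens b y * (X y)\<^sup>2 + dens a y * (X y)\<^sup>2 \<partial>lborel)"
    by (intro integral_mono intX Bochner_Integration.integrable_add Bochner_Integration.integrable_diff intA intB inta intb pw)
  also have "\<dots> = (\<integral>y. dens b y \<partial>lborel) - (\<integral>y. dens a y * indicator {g b..} y \<partial>lborel)
      + (\<integral>y. dens b y * (X y)\<^sup>2 \<partial>lborel) + (\<integral>y. dens a y * (X y)\<^sup>2 \<partial>lborel)"
    using intA intB inta intb by simp
  also have "(\<integral>y. dens a y * indicator {g b..} y \<partial>lborel) = measure (law a) {g b..}"
    using in\<Theta> by (subst measure_law) auto
  also have "(\<integral>y. dens b y \<partial>lborel) = 1"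
    using measure_law[OF in\<Theta>(2), of UNIV] B.prob_space by simp
  also have "1 - measure (law a) {g b..} + (\<integral>y. dens b y * (X y)\<^sup>2 \<partial>lborel) + (\<integral>y. dens a y * (X y)\<^sup>2 \<partial>lborel)
      \<le> (1 - measure (law a) {g b..}) + 2 * score_bound * (b - a)\<^sup>2"
    using EA EB by simp
  also have "1 - measure (law a) {g b..} = measure (law a) {..<g b}"
    using A.prob_compl[of "{g b..}"] by (simp add: Compl_eq_Diff_UNIV[symmetric])
  also have "measure (law a) {..<g b} \<le> measure (law a) {..g b}"
    by (intro A.finite_measure_mono) auto
  finally show "(\<integral>y. ln (ratio a b y) \<partial>law b) \<le> measure (law a) {..g b} + 2 * score_bound * (b - a)\<^sup>2"
    by (simp add: X_def)
qed

section \<open>The power bound\<close>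

text \<open>
  The mean of the log likelihood ratio of the sample is at most \<open>rate * h + o(1)\<close> and its variance is
  \<open>O(1/n)\<close>, so it is unlikely to exceed \<open>ln c > rate * h\<close>.
\<close>

lemma likelihood_ratio_tail:
  assumes "0 < h" and c: "exp (rate * h) < c"
  shows "(\<lambda>n. measure (local_law YY f g \<theta>\<^sub>0 n h)
      {y \<in> space (local_law YY f g \<theta>\<^sub>0 n h). c < (\<Prod>i<n. ratio \<theta>\<^sub>0 (\<theta>\<^sub>0 + h / real n) (y i))}) \<longlonglongrightarrow> 0"
proof -
  have "0 < c" using c by (rule less_trans[OF exp_gt_zero])
  \<comment> \<open>Half of the gap absorbs the error in the mean, the other half is left to Chebyshev's inequality.\<close>
  define \<epsilon> where "\<epsilon> = (ln c - rate * h) / 2"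
  have "rate * h < ln c" using c \<open>0 < c\<close> by (metis exp_less_cancel_iff exp_ln)
  then have \<epsilon>: "0 < \<epsilon>" unfolding \<epsilon>_def by simp
  define \<theta> where "\<theta> n = \<theta>\<^sub>0 + h / real n" for n
  define X where "X n y = ln (ratio \<theta>\<^sub>0 (\<theta> n) y)" for n y
  have mean_bound: "(\<lambda>n. real n * measure (law \<theta>\<^sub>0) {..g (\<theta> n)} + 2 * score_bound * h\<^sup>2 / real n) \<longlonglongrightarrow> rate * h"
    using tendsto_add[OF local_boundary_mass[of 0 h] lim_const_over_n[of "2 * score_bound * h\<^sup>2"]] \<open>0 < h\<close>
    by (simp add: \<theta>_def)
  have ev_mean: "\<forall>\<^sub>F n in sequentially. real n * measure (law \<theta>\<^sub>0) {..g (\<theta> n)} + 2 * score_bound * h\<^sup>2 / real n < rate * h + \<epsilon>"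
    by (rule order_tendstoD[OF mean_bound]) (use \<epsilon> in auto)
  show ?thesis
  proof (rule Lim_null_comparison)
    show "(\<lambda>n. score_bound * h\<^sup>2 / \<epsilon>\<^sup>2 / real n) \<longlonglongrightarrow> 0" by (rule lim_const_over_n)
    show "\<forall>\<^sub>F n in sequentially. norm (measure (local_law YY f g \<theta>\<^sub>0 n h)
      {y \<in> space (local_law YY f g \<theta>\<^sub>0 n h). c < (\<Prod>i<n. ratio \<theta>\<^sub>0 (\<theta>\<^sub>0 + h / real n) (y i))})
      \<le> score_bound * h\<^sup>2 / \<epsilon>\<^sup>2 / real n"
      using ev_mean eventually_gt_at_top[of 0] eventually_local_segment[of h]
        g_local_mono[of 0 h, OF less_imp_le[OF \<open>0 < h\<close>]]
    proof eventually_elim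
      case (elim n)
      have lt: "\<theta>\<^sub>0 < \<theta> n" using elim \<open>0 < h\<close> by (simp add: \<theta>_def)
      have seg: "{\<theta>\<^sub>0..\<theta> n} \<subseteq> N" and gle: "g \<theta>\<^sub>0 \<le> g (\<theta> n)" using elim by (simp_all add: \<theta>_def)
      have in\<Theta>: "\<theta>\<^sub>0 \<in> \<Theta>" "\<theta> n \<in> \<Theta>" using subsetD[OF subset_trans[OF seg N_subset]] lt by auto
      define P where "P = Pi\<^sub>M {..<n} (\<lambda>_. law (\<theta> n))"
      have P: "local_law YY f g \<theta>\<^sub>0 n h = P" by (simp add: local_law_def P_def \<theta>_def)
      have prob: "prob_space (law (\<theta> n))" by (rule prob_space_law) fact
      interpret P: prob_space P unfolding P_def by (intro prob_space_PiM prob)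
      have Xm: "X n \<in> borel_measurable (law (\<theta> n))" unfolding X_def[abs_def] using in\<Theta> by measurable
      have Xm'[measurable]: "X n \<in> borel_measurable borel" unfolding X_def[abs_def] using in\<Theta> by measurable
      have diff: "\<theta> n - \<theta>\<^sub>0 = h / real n" by (simp add: \<theta>_def)
      have "real n * (\<integral>y. X n y \<partial>law (\<theta> n))
          \<le> real n * (measure (law \<theta>\<^sub>0) {..g (\<theta> n)} + 2 * score_bound * (h / real n)\<^sup>2)"
        using law_log_ratio_mean[OF lt seg gle] unfolding diff X_def by (intro mult_left_mono) auto
      also have "\<dots> = real n * measure (law \<theta>\<^sub>0) {..g (\<theta> n)} + 2 * score_bound * h\<^sup>2 / real n"
        using elim by (simp add: field_simps power2_eq_square)
      also have "\<dots> \<le> rate * h + \<epsilon>" using elim by simp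
      finally have mean: "real n * (\<integral>y. X n y \<partial>law (\<theta> n)) + \<epsilon> \<le> ln c" by (simp add: \<epsilon>_def field_simps)
      have sub: "{y \<in> space P. c < (\<Prod>i<n. ratio \<theta>\<^sub>0 (\<theta> n) (y i))}
          \<subseteq> {y \<in> space P. real n * (\<integral>y. X n y \<partial>law (\<theta> n)) + \<epsilon> \<le> (\<Sum>i<n. X n (y i))}"
      proof safe
        fix y assume "c < (\<Prod>i<n. ratio \<theta>\<^sub>0 (\<theta> n) (y i))"
        also have "\<dots> \<le> (\<Prod>i<n. exp (X n (y i)))"
        proof (intro prod_mono conjI ratio_nonneg in\<Theta>)
          fix i
          show "ratio \<theta>\<^sub>0 (\<theta> n) (y i) \<le> exp (X n (y i))"
            using ratio_nonneg[OF in\<Theta>, of "y i"] by (cases "ratio \<theta>\<^sub>0 (\<theta> n) (y i) = 0") (auto simp: X_def)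
        qed
        also have "\<dots> = exp (\<Sum>i<n. X n (y i))" by (simp add: exp_sum)
        finally have "ln c < (\<Sum>i<n. X n (y i))" using \<open>0 < c\<close> by (metis exp_less_cancel_iff exp_ln)
        then show "real n * (\<integral>y. X n y \<partial>law (\<theta> n)) + \<epsilon> \<le> (\<Sum>i<n. X n (y i))" using mean by simp
      qed
      have "measure P {y \<in> space P. c < (\<Prod>i<n. ratio \<theta>\<^sub>0 (\<theta> n) (y i))}
          \<le> measure P {y \<in> space P. real n * (\<integral>y. X n y \<partial>law (\<theta> n)) + \<epsilon> \<le> (\<Sum>i<n. X n (y i))}"
        by (rule P.finite_measure_mono[OF sub]) (unfold P_def, measurable)
      also have "\<dots> \<le> real n * (\<integral>y. (X n y)\<^sup>2 \<partial>law (\<theta> n)) / \<epsilon>\<^sup>2"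
        unfolding P_def
        by (rule iid_sum_upper_tail[OF prob Xm _ \<epsilon>])
           (use law_integrable_log_ratio_sq[OF lt seg gle] in \<open>simp add: X_def\<close>)
      also have "\<dots> \<le> real n * (score_bound * (h / real n)\<^sup>2) / \<epsilon>\<^sup>2"
        using law_log_ratio_second_moment[OF lt seg gle] unfolding diff X_def
        by (intro divide_right_mono mult_left_mono) auto
      also have "\<dots> = score_bound * h\<^sup>2 / \<epsilon>\<^sup>2 / real n"
        using elim by (simp add: field_simps power2_eq_square)
      finally show ?case unfolding P by (simp add: \<theta>_def)
    qed
  qed
qed

lemma sets_local_law [measurable_cong]: "sets (local_law YY f g \<theta>\<^sub>0 n h) = sets (Pi\<^sub>M {..<n} (\<lambda>_. borel))"
  unfolding local_law_def by (intro sets_PiM_cong) auto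

lemma test_power_le:
  assumes "test_seq \<psi>" "0 < h" "0 \<le> c"
  shows "\<forall>\<^sub>F n in sequentially. (\<integral>y. \<psi> n y \<partial>local_law YY f g \<theta>\<^sub>0 n h)
    \<le> c * (\<integral>y. \<psi> n y \<partial>local_law YY f g \<theta>\<^sub>0 n 0) + measure (local_law YY f g \<theta>\<^sub>0 n h)
      {y \<in> space (local_law YY f g \<theta>\<^sub>0 n h). c < (\<Prod>i<n. ratio \<theta>\<^sub>0 (\<theta>\<^sub>0 + h / real n) (y i))}"
  using eventually_ge_at_top[of 1] eventually_local_segment[of h]
    g_local_mono[of 0 h, OF less_imp_le[OF \<open>0 < h\<close>]]
proof eventually_elim
  case (elim n)
  define \<theta> where "\<theta> = \<theta>\<^sub>0 + h / real n"
  have inN: "\<theta>\<^sub>0 \<in> N" "\<theta> \<in> N" using elim \<open>0 < h\<close> by (auto simp: \<theta>_def)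
  then have in\<Theta>: "\<theta>\<^sub>0 \<in> \<Theta>" "\<theta> \<in> \<Theta>" using N_subset by auto
  have law: "law \<theta> = density (law \<theta>\<^sub>0) (ratio \<theta>\<^sub>0 \<theta>)"
    using elim inN by (intro law_eq_density_ratio) (auto simp: \<theta>_def)
  define P where "P = local_law YY f g \<theta>\<^sub>0 n 0"
  define L where "L y = (\<Prod>i<n. ratio \<theta>\<^sub>0 \<theta> (y i))" for y
  have P: "P = Pi\<^sub>M {..<n} (\<lambda>_. law \<theta>\<^sub>0)" by (simp add: P_def local_law_def)
  have Q: "local_law YY f g \<theta>\<^sub>0 n h = density P L"
  proof -
    have "density P L = Pi\<^sub>M {..<n} (\<lambda>_. density (law \<theta>\<^sub>0) (ratio \<theta>\<^sub>0 \<theta>))"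
      unfolding P L_def
    proof (rule density_PiM_const)
      show "prob_space (density (law \<theta>\<^sub>0) (ratio \<theta>\<^sub>0 \<theta>))"
        unfolding law[symmetric] using in\<Theta> by (rule_tac prob_space_law)
    qed (use in\<Theta> ratio_nonneg prob_space_law in auto)
    then show ?thesis by (simp add: local_law_def \<theta>_def[symmetric] law)
  qed
  have spP: "space P = space (Pi\<^sub>M {..<n} (\<lambda>_. borel :: real measure))"
    unfolding P_def by (intro sets_eq_imp_space_eq sets_local_law)
  have [measurable]: "\<psi> n \<in> borel_measurable P"
    unfolding P_def using assms(1) elim by (simp add: test_seq_def cong: measurable_cong_sets) (metis measurable_cong_sets sets_local_law)
  have "(\<integral>y. \<psi> n y \<partial>density P L) \<le> c * (\<integral>y. \<psi> n y \<partial>P) + measure (density P L) {y \<in> space P. c < L y}"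
  proof (rule expectation_le_likelihood_bound)
    show "prob_space P" unfolding P by (intro prob_space_PiM prob_space_law in\<Theta>)
    show "L \<in> borel_measurable P" unfolding P L_def using in\<Theta> by measurable
    show "0 \<le> L y" for y unfolding L_def by (intro prod_nonneg ballI ratio_nonneg in\<Theta>)
    show "prob_space (density P L)"
      unfolding Q[symmetric] local_law_def \<theta>_def[symmetric] by (intro prob_space_PiM prob_space_law in\<Theta>)
    show "0 \<le> \<psi> n y \<and> \<psi> n y \<le> 1" if "y \<in> space P" for y
      using assms(1) elim that by (auto simp: test_seq_def spP)
  qed (use assms in auto)
  then show ?case by (simp add: Q L_def P_def \<theta>_def)
qed

text \<open>
  For \<open>c = e\<^sup>r\<^sup>h + \<delta>\<close> the change of measure bounds the power by \<open>c (\<alpha> + \<delta>) + \<delta>\<close> for all large \<open>n\<close>,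
  where \<open>r\<close> is the rate; then \<open>\<delta>\<close> tends to 0.
\<close>

lemma asymptotic_power_bound:
  assumes \<psi>: "test_seq \<psi>" and "0 < h" "0 < \<alpha>"
    and level: "limsup (\<lambda>n. ereal (\<integral>y. \<psi> n y \<partial>local_law YY f g \<theta>\<^sub>0 n 0)) \<le> ereal \<alpha>"
  shows "limsup (\<lambda>n. ereal (\<integral>y. \<psi> n y \<partial>local_law YY f g \<theta>\<^sub>0 n h)) \<le> ereal (min 1 (\<alpha> * exp (rate * h)))"
proof -
  define E where "E n k = (\<integral>y. \<psi> n y \<partial>local_law YY f g \<theta>\<^sub>0 n k)" for n k
  have "limsup (\<lambda>n. ereal (E n h)) \<le> ereal 1"
  proof (rule Limsup_bounded)
    show "\<forall>\<^sub>F n in sequentially. ereal (E n h) \<le> ereal 1"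
      using eventually_ge_at_top[of 1] eventually_local_parameter[of h]
    proof eventually_elim
      case (elim n)
      interpret P: prob_space "local_law YY f g \<theta>\<^sub>0 n h"
        unfolding local_law_def using elim N_subset by (intro prob_space_PiM prob_space_law) auto
      have sp: "space (local_law YY f g \<theta>\<^sub>0 n h) = space (Pi\<^sub>M {..<n} (\<lambda>_. borel :: real measure))"
        by (intro sets_eq_imp_space_eq sets_local_law)
      have m: "\<psi> n \<in> borel_measurable (local_law YY f g \<theta>\<^sub>0 n h)"
        using \<psi> elim by (subst measurable_cong_sets[OF sets_local_law refl]) (auto simp: test_seq_def)
      have b: "0 \<le> \<psi> n y \<and> \<psi> n y \<le> 1" if "y \<in> space (local_law YY f g \<theta>\<^sub>0 n h)" for y
        using \<psi> elim that by (auto simp: test_seq_def sp)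
      have "E n h \<le> 1"
        unfolding E_def using b m
        by (intro P.integral_le_const P.integrable_const_bound[where B = 1]) auto
      then show ?case by simp
    qed
  qed
  moreover have "limsup (\<lambda>n. ereal (E n h)) \<le> ereal (\<alpha> * exp (rate * h))"
  proof -
    have bound: "limsup (\<lambda>n. ereal (E n h)) \<le> ereal ((exp (rate * h) + \<delta>) * (\<alpha> + \<delta>) + \<delta>)" if "0 < \<delta>" for \<delta>
    proof (rule Limsup_bounded)
      define c where "c = exp (rate * h) + \<delta>"
      have c: "exp (rate * h) < c" "0 \<le> c" using that by (auto simp: c_def add_nonneg_nonneg)
      have "limsup (\<lambda>n. ereal (E n 0)) < ereal (\<alpha> + \<delta>)"
        using level that by (auto simp: E_def intro: le_less_trans)
      then have e0: "\<forall>\<^sub>F n in sequentially. ereal (E n 0) < ereal (\<alpha> + \<delta>)" by (rule Limsup_lessD)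
      have e1: "\<forall>\<^sub>F n in sequentially. measure (local_law YY f g \<theta>\<^sub>0 n h)
          {y \<in> space (local_law YY f g \<theta>\<^sub>0 n h). c < (\<Prod>i<n. ratio \<theta>\<^sub>0 (\<theta>\<^sub>0 + h / real n) (y i))} < \<delta>"
        by (rule order_tendstoD[OF likelihood_ratio_tail[OF \<open>0 < h\<close> c(1)]]) fact
      show "\<forall>\<^sub>F n in sequentially. ereal (E n h) \<le> ereal ((exp (rate * h) + \<delta>) * (\<alpha> + \<delta>) + \<delta>)"
        using e0 e1 test_power_le[OF \<psi> \<open>0 < h\<close> c(2)]
      proof eventually_elim
        case (elim n)
        have "c * E n 0 \<le> c * (\<alpha> + \<delta>)" using elim c by (intro mult_left_mono) auto
        then show ?case using elim by (simp add: E_def c_def[symmetric])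
      qed
    qed
    have "((\<lambda>\<delta>. (exp (rate * h) + \<delta>) * (\<alpha> + \<delta>) + \<delta>) \<longlongrightarrow> (exp (rate * h) + 0) * (\<alpha> + 0) + 0) (at_right 0)"
      by (intro tendsto_intros)
    then have "((\<lambda>\<delta>. ereal ((exp (rate * h) + \<delta>) * (\<alpha> + \<delta>) + \<delta>)) \<longlongrightarrow> ereal (\<alpha> * exp (rate * h))) (at_right 0)"
      by (simp add: mult.commute)
    then show ?thesis
      by (rule tendsto_lowerbound) (auto intro!: bound eventually_at_right_less[THEN eventually_mono])
  qed
  ultimately have "limsup (\<lambda>n. ereal (E n h)) \<le> min (ereal 1) (ereal (\<alpha> * exp (rate * h)))"
    by (rule min.boundedI)
  then show ?thesis by (simp add: E_def)
qed

end

section \<open>Optimality of the minimum test\<close>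

theorem theorem1:
  fixes YY \<Theta> H N :: "real set" and \<theta>\<^sub>0 C \<alpha> lam :: real
    and f f\<^sub>1 f\<^sub>2 :: "real \<Rightarrow> real \<Rightarrow> real" and g g\<^sub>1 :: "real \<Rightarrow> real"
  assumes "0 < \<alpha>" and "\<alpha> < 1"
    and "boundary_model YY \<Theta> \<theta>\<^sub>0 H f f\<^sub>1 f\<^sub>2 g g\<^sub>1 N C"
    and "lam = inverse (f (g \<theta>\<^sub>0) \<theta>\<^sub>0 * g\<^sub>1 \<theta>\<^sub>0)"
  shows "aump (local_law YY f g \<theta>\<^sub>0) {h \<in> H. h \<le> 0} {h \<in> H. h > 0} \<alpha> (phi_minus g \<theta>\<^sub>0 lam \<alpha>)"
proof -
  interpret boundary_model YY \<Theta> \<theta>\<^sub>0 H f f\<^sub>1 f\<^sub>2 g g\<^sub>1 N C by fact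
  have lam: "lam = inverse rate" using assms by (simp add: rate_def)
  have lim: "(\<lambda>n. ereal (\<integral>y. phi_minus g \<theta>\<^sub>0 lam \<alpha> n y \<partial>local_law YY f g \<theta>\<^sub>0 n h))
      \<longlonglongrightarrow> ereal (min 1 (\<alpha> * exp (rate * h)))" for h
    unfolding lam by (intro tendsto_ereal phi_minus_power_limit assms)
  show ?thesis
    unfolding aump_def
  proof (intro conjI allI impI ballI)
    show "test_seq (phi_minus g \<theta>\<^sub>0 lam \<alpha>)"
      unfolding test_seq_def using phi_minus_measurable by (auto simp: phi_minus_def)
    show "asymp_level (local_law YY f g \<theta>\<^sub>0) {h \<in> H. h \<le> 0} \<alpha> (phi_minus g \<theta>\<^sub>0 lam \<alpha>)"
      unfolding asymp_level_def
    proof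
      fix h assume "h \<in> {h \<in> H. h \<le> 0}"
      then have "\<alpha> * exp (rate * h) \<le> \<alpha> * 1"
        using rate_pos assms(1) by (intro mult_left_mono) (auto simp: mult_le_0_iff)
      then show "limsup (\<lambda>n. ereal (\<integral>y. phi_minus g \<theta>\<^sub>0 lam \<alpha> n y \<partial>local_law YY f g \<theta>\<^sub>0 n h)) \<le> ereal \<alpha>"
        using lim_imp_Limsup[OF sequentially_bot lim[of h]] by (simp add: min.coboundedI2)
    qed
  next
    fix \<psi> h
    assume \<psi>: "test_seq \<psi>" and level: "asymp_level (local_law YY f g \<theta>\<^sub>0) {h \<in> H. h \<le> 0} \<alpha> \<psi>"
      and h: "h \<in> {h \<in> H. h > 0}"
    have "limsup (\<lambda>n. ereal (\<integral>y. \<psi> n y \<partial>local_law YY f g \<theta>\<^sub>0 n h)) \<le> ereal (min 1 (\<alpha> * exp (rate * h)))"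
    proof (rule asymptotic_power_bound[OF \<psi>])
      show "limsup (\<lambda>n. ereal (\<integral>y. \<psi> n y \<partial>local_law YY f g \<theta>\<^sub>0 n 0)) \<le> ereal \<alpha>"
        using level zero_in_H unfolding asymp_level_def by auto
    qed (use h assms(1) in auto)
    also have "\<dots> = liminf (\<lambda>n. ereal (\<integral>y. phi_minus g \<theta>\<^sub>0 lam \<alpha> n y \<partial>local_law YY f g \<theta>\<^sub>0 n h))"
      using lim_imp_Liminf[OF sequentially_bot lim[of h]] by simp
    finally show "limsup (\<lambda>n. ereal (\<integral>y. \<psi> n y \<partial>local_law YY f g \<theta>\<^sub>0 n h))
      \<le> liminf (\<lambda>n. ereal (\<integral>y. phi_minus g \<theta>\<^sub>0 lam \<alpha> n y \<partial>local_law YY f g \<theta>\<^sub>0 n h))" .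
  qed
qed

end
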